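(* Let $G=(V,E)$ be a finite directed graph with $n=|V|$, with propagation probabilities $\Pr[e]\in(0,1]$ for $e\in E$, let $S_r\subseteq V$ be the seed set of the misinformation, let $k\in\mathbb{Z}^+$, $\epsilon\in(0,1)$ and $N>1$. Let $S_{\mathrm{opt}}$ be a maximizer of $f^*(S)$ over all $S\subseteq V$ with $|S|\le k$. Then, with probability at least $1-3/N$, the HMP algorithm (defined in the context) returns a solution $S^*$ such that \[f^*(S^* )\ \ge\ (1-1/e-\epsilon)\, f^*(S_{\mathrm{opt}}).\]
   Context: **Diffusion model.** Each edge $e\in E$ is independently live with probability $\Pr[e]$ and not live otherwise. A full-realization $g$ fixes the state of every edge; it is identified with the subgraph of $G$ formed by its live edges. Given $g$ and a seed set $S\subseteq V$ of the positive cascade $C_p$, the diffusion is deterministic and proceeds in rounds: at time $0$ nodes in $S_r$ are $C_r$-active (misinformation) and nodes in $S\setminus S_r$ are $C_p$-active; at time $t+1$ every still inactive node having a live incoming edge from a node that became active at time $t$ becomes active, and it becomes $C_r$-active if at least one such in-neighbor is $C_r$-active (the misinformation has priority), and $C_p$-active otherwise. Active nodes never change state. $f(S)$ is the expected (over the random realization) number of nodes that never become $C_r$-active, and $f^*(S):=f(S)-f(\emptyset)$. **R-sample (hybrid sampling).** One R-sample $\mathcal{P}$ is a random finite family (with multiplicity) of subsets of $V$ generated as follows. Each edge's state is sampled at most once during the whole procedure (live with probability $\Pr[e]$, independently), and a sampled state is kept afterwards. (1) Forward step: simulate the diffusion of the misinformation from $S_r$ without positive cascade, sampling edge states as needed;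 let $V_r$ be the set of $C_r$-active nodes at termination. (2) Reverse step: for each $v\in V_r$, in an arbitrary order, compute a set $P\subseteq V$ and add it to $\mathcal{P}$: start with $P^*=\{v\}$, $P=\emptyset$; repeat: if $P^*\cap S_r\ne\emptyset$ stop and return $P$; else set $P\leftarrow P\cup P^*$, let $E^*$ be the set of edges $(u_1,u_2)\in E$ with $u_2\in P^*$ and $u_1\in V\setminus P$, and replace $P^*$ by the set of all $u_1$ such that some $(u_1,u_2)\in E^*$ is live (sampling the states of edges in $E^*$ not yet sampled). For $V_1,V_2\subseteq V$, $y(V_1,V_2)=1$ if $V_1\cap V_2\neq\emptyset$ and $0$ otherwise; $x(\mathcal{P},S):=\sum_{P\in\mathcal{P}}y(P,S)$ (counted with multiplicity). For a collection $\mathcal{R}_l=\{\mathcal{P}_1,\dots,\mathcal{P}_l\}$ of $l$ R-samples, $\overline{x}(\mathcal{R}_l,S):=\frac1l\sum_{i=1}^l x(\mathcal{P}_i,S)$. **Greedy algorithm** with input $\mathcal{R}_l,V,k$: start with $S^*=\emptyset$; while $|S^*|<k$, choose $v^*\in V\setminus S^*$ maximizing $\overline{x}(\mathcal{R}_l,S^*\cup\{v^*\})$ and add $v^*$ to $S^*$; return $S^*$. **HMP algorithm** (input $G,\epsilon,N,S_r,k$). 1. Select any subset $S_L\subseteq V$ with $|S_L|=k$ and compute, by the Monte Carlo estimation algorithm of Dagum et al., a number $OPT_L$ which with probability at least $1-1/N$ satisfies $(1-\epsilon_0)f^*(S_L)\le OPT_L\le(1+\epsilon_0)f^*(S_L)$,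 where $\epsilon_0=\epsilon^2+2\epsilon$. (This guarantee of the estimation algorithm is taken as given.) 2. Compute $\epsilon_{11},\epsilon_{12}$ by minimizing $\max(l_1,l_2)$ subject to $\epsilon_{11},\epsilon_{12}\in(0,1)$ and \[(1-\epsilon_{12}(1+\epsilon))(1-1/e)-\epsilon_{11}(1+\epsilon)=1-1/e-\epsilon,\] where \[l_1:=\frac{n\left(\ln\binom nk+\ln N\right)(2+\epsilon_{11}(1+\epsilon))}{\epsilon_{11}^2},\qquad l_2:=\frac{2n\ln N}{\epsilon_{12}^2}.\] 3. Set $l=\max(l_1,l_2)/OPT_L$. 4. Generate $l$ R-samples $\mathcal{R}_l=\{\mathcal{P}_1,\dots,\mathcal{P}_l\}$ by independent runs of the hybrid sampling procedure, and return the output $S^*$ of the greedy algorithm on $\mathcal{R}_l,V,k$.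
   Formalization: The estimation guarantee is taken to include OPT_L > 0 (so f*(S_L) > 0), since otherwise l = max(l_1,l_2)/OPT_L is undefined, e.g. when S_L is contained in S_r; l is rounded up to an integer. *)

theory Defs
  imports
    "HOL-Probability.Probability"
    "HOL-Library.Multiset"
    "HOL-Library.While_Combinator"
    "Graph_Theory.Pair_Digraph"
begin

section \<open>Diffusion and the objective function\<close>

type_synonym 'v prob_fun = "'v \<times> 'v \<Rightarrow> real"

text \<open>A full-realization \<open>g\<close> is a map from edges to states (\<open>True\<close> = live).\<close>

definition realization :: "'v pair_pre_digraph \<Rightarrow> 'v prob_fun \<Rightarrow> ('v \<times> 'v \<Rightarrow> bool) pmf" where
  "realization G pr = Pi_pmf (parcs G) False (\<lambda>e. bernoulli_pmf (pr e))"

text \<open>\<open>diffusion G g Sr S t = (R, P, \<Delta>R, \<Delta>P)\<close>: \<open>R\<close> and \<open>P\<close> are the sets of nodes that are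
  misinformation-active and positively active at time \<open>t\<close>; \<open>\<Delta>R\<close> and \<open>\<Delta>P\<close> consist of those
  nodes among them that became active at time \<open>t\<close>.\<close>

primrec diffusion ::
  "'v pair_pre_digraph \<Rightarrow> ('v \<times> 'v \<Rightarrow> bool) \<Rightarrow> 'v set \<Rightarrow> 'v set \<Rightarrow> nat
    \<Rightarrow> 'v set \<times> 'v set \<times> 'v set \<times> 'v set" where
  "diffusion G g Sr S 0 = (Sr, S - Sr, Sr, S - Sr)"
| "diffusion G g Sr S (Suc t) =
    (let (R, P, \<Delta>R, \<Delta>P) = diffusion G g Sr S t;
         New = {v \<in> pverts G - (R \<union> P). \<exists>u \<in> \<Delta>R \<union> \<Delta>P. (u, v) \<in> parcs G \<and> g (u, v)};
         NewR = {v \<in> New. \<exists>u \<in> \<Delta>R. (u, v) \<in> parcs G \<and> g (u, v)}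
     in (R \<union> NewR, P \<union> (New - NewR), NewR, New - NewR))"

definition never_misinformed ::
  "'v pair_pre_digraph \<Rightarrow> ('v \<times> 'v \<Rightarrow> bool) \<Rightarrow> 'v set \<Rightarrow> 'v set \<Rightarrow> 'v set" where
  "never_misinformed G g Sr S = {v \<in> pverts G. \<forall>t. v \<notin> fst (diffusion G g Sr S t)}"

definition f_obj :: "'v pair_pre_digraph \<Rightarrow> 'v prob_fun \<Rightarrow> 'v set \<Rightarrow> 'v set \<Rightarrow> real" where
  "f_obj G pr Sr S =
    measure_pmf.expectation (realization G pr) (\<lambda>g. real (card (never_misinformed G g Sr S)))"

definition f_star :: "'v pair_pre_digraph \<Rightarrow> 'v prob_fun \<Rightarrow> 'v set \<Rightarrow> 'v set \<Rightarrow> real" where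
  "f_star G pr Sr S = f_obj G pr Sr S - f_obj G pr Sr {}"


section \<open>Hybrid sampling\<close>

text \<open>The states sampled so far are kept in a partial map, which is threaded through the whole
  procedure, so that an edge is sampled at most once. The loops are partial functions in the
  monad of subprobability mass functions: non-termination shows up as missing mass.\<close>

type_synonym 'v edge_states = "'v \<times> 'v \<Rightarrow> bool option"

definition sample_edges ::
  "'v prob_fun \<Rightarrow> ('v \<times> 'v) set \<Rightarrow> 'v edge_states \<Rightarrow> 'v edge_states pmf" where
  "sample_edges pr F st =
    map_pmf (\<lambda>g e. if e \<in> F \<and> st e = None then Some (g e) else st e)
      (Pi_pmf {e \<in> F. st e = None} False (\<lambda>e. bernoulli_pmf (pr e)))"

text \<open>\<open>A\<close> is the set of active nodes, \<open>D\<close> the set of those activated in the last round.\<close>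

partial_function (spmf) forward_step ::
  "'v pair_pre_digraph \<Rightarrow> 'v prob_fun \<Rightarrow> 'v set \<Rightarrow> 'v set \<Rightarrow> 'v edge_states
    \<Rightarrow> ('v set \<times> 'v edge_states) spmf" where
  "forward_step G pr A D st =
    (if D = {} then return_spmf (A, st)
     else bind_pmf (sample_edges pr {(u, v) \<in> parcs G. u \<in> D \<and> v \<in> pverts G - A} st) (\<lambda>st'.
       let New = {v \<in> pverts G - A. \<exists>u \<in> D. (u, v) \<in> parcs G \<and> st' (u, v) = Some True}
       in forward_step G pr (A \<union> New) New st'))"

text \<open>\<open>Q\<close> and \<open>P\<close> play the roles of $P^*$ and $P$.\<close>

partial_function (spmf) reverse_step ::
  "'v pair_pre_digraph \<Rightarrow> 'v prob_fun \<Rightarrow> 'v set \<Rightarrow> 'v set \<Rightarrow> 'v set \<Rightarrow> 'v edge_states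
    \<Rightarrow> ('v set \<times> 'v edge_states) spmf" where
  "reverse_step G pr Sr Q P st =
    (if Q \<inter> Sr \<noteq> {} then return_spmf (P, st)
     else
       let P' = P \<union> Q;
           F = {(u1, u2) \<in> parcs G. u2 \<in> Q \<and> u1 \<in> pverts G - P'}
       in bind_pmf (sample_edges pr F st) (\<lambda>st'.
         reverse_step G pr Sr {u1. \<exists>u2. (u1, u2) \<in> F \<and> st' (u1, u2) = Some True} P' st'))"

primrec reverse_all ::
  "'v pair_pre_digraph \<Rightarrow> 'v prob_fun \<Rightarrow> 'v set \<Rightarrow> 'v list \<Rightarrow> 'v edge_states
    \<Rightarrow> 'v set multiset spmf" where
  "reverse_all G pr Sr [] st = return_spmf {#}"
| "reverse_all G pr Sr (v # vs) st =
    bind_spmf (reverse_step G pr Sr {v} {} st) (\<lambda>(P, st').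
      map_spmf (add_mset P) (reverse_all G pr Sr vs st'))"

text \<open>\<open>ord\<close> gives the order in which the nodes of \<open>V\<^sub>r\<close> are processed.\<close>

definition r_sample ::
  "'v pair_pre_digraph \<Rightarrow> 'v prob_fun \<Rightarrow> 'v set \<Rightarrow> ('v set \<Rightarrow> 'v list) \<Rightarrow> 'v set multiset spmf" where
  "r_sample G pr Sr ord =
    bind_spmf (forward_step G pr Sr Sr Map.empty) (\<lambda>(Vr, st). reverse_all G pr Sr (ord Vr) st)"

primrec replicate_spmf :: "nat \<Rightarrow> 'a spmf \<Rightarrow> 'a list spmf" where
  "replicate_spmf 0 p = return_spmf []"
| "replicate_spmf (Suc m) p = bind_spmf p (\<lambda>x. map_spmf ((#) x) (replicate_spmf m p))"

definition y_cov :: "'v set \<Rightarrow> 'v set \<Rightarrow> real" where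
  "y_cov V1 V2 = (if V1 \<inter> V2 \<noteq> {} then 1 else 0)"

definition x_cov :: "'v set multiset \<Rightarrow> 'v set \<Rightarrow> real" where
  "x_cov \<P> S = (\<Sum>P \<in># \<P>. y_cov P S)"

definition x_bar :: "'v set multiset list \<Rightarrow> 'v set \<Rightarrow> real" where
  "x_bar Rl S = (\<Sum>\<P> \<leftarrow> Rl. x_cov \<P> S) / real (length Rl)"


section \<open>Greedy and HMP\<close>

text \<open>The maximizing node need not be unique. \<open>sel Rl S\<close> is the node that is picked when the
  current solution is \<open>S\<close>; every way of resolving ties is an instance of such a \<open>sel\<close>.\<close>

definition greedy_rule ::
  "'v set \<Rightarrow> ('v set multiset list \<Rightarrow> 'v set \<Rightarrow> 'v) \<Rightarrow> bool" where
  "greedy_rule V sel \<longleftrightarrow>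
    (\<forall>Rl S. S \<subset> V \<longrightarrow> is_arg_max (\<lambda>v. x_bar Rl (S \<union> {v})) (\<lambda>v. v \<in> V - S) (sel Rl S))"

definition greedy ::
  "('v set multiset list \<Rightarrow> 'v set \<Rightarrow> 'v) \<Rightarrow> nat \<Rightarrow> 'v set multiset list \<Rightarrow> 'v set" where
  "greedy sel k Rl = while (\<lambda>S. card S < k) (\<lambda>S. S \<union> {sel Rl S}) {}"

definition l1 :: "nat \<Rightarrow> nat \<Rightarrow> real \<Rightarrow> real \<Rightarrow> real \<Rightarrow> real" where
  "l1 n k N \<epsilon> \<epsilon>11 =
    real n * (ln (real (n choose k)) + ln N) * (2 + \<epsilon>11 * (1 + \<epsilon>)) / \<epsilon>11\<^sup>2"

definition l2 :: "nat \<Rightarrow> real \<Rightarrow> real \<Rightarrow> real" where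
  "l2 n N \<epsilon>12 = 2 * real n * ln N / \<epsilon>12\<^sup>2"

definition feasible_eps :: "real \<Rightarrow> real \<times> real \<Rightarrow> bool" where
  "feasible_eps \<epsilon> = (\<lambda>(\<epsilon>11, \<epsilon>12).
    \<epsilon>11 \<in> {0<..<1} \<and> \<epsilon>12 \<in> {0<..<1} \<and>
    (1 - \<epsilon>12 * (1 + \<epsilon>)) * (1 - 1 / exp 1) - \<epsilon>11 * (1 + \<epsilon>) = 1 - 1 / exp 1 - \<epsilon>)"

definition optimal_eps :: "nat \<Rightarrow> nat \<Rightarrow> real \<Rightarrow> real \<Rightarrow> real \<times> real \<Rightarrow> bool" where
  "optimal_eps n k N \<epsilon> =
    is_arg_min (\<lambda>(\<epsilon>11, \<epsilon>12). max (l1 n k N \<epsilon> \<epsilon>11) (l2 n N \<epsilon>12)) (feasible_eps \<epsilon>)"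

text \<open>\<open>est\<close> is the output distribution of the Monte Carlo estimation of the first step and
  \<open>(\<epsilon>11, \<epsilon>12)\<close> are the parameters computed in the second step. The sample size is rounded up to an
  integer. It is meaningful only for a positive estimate; for any other estimate there is no
  output.\<close>

definition hmp ::
  "'v pair_pre_digraph \<Rightarrow> 'v prob_fun \<Rightarrow> 'v set \<Rightarrow> nat \<Rightarrow> real \<Rightarrow> real
    \<Rightarrow> real pmf \<Rightarrow> real \<times> real
    \<Rightarrow> ('v set \<Rightarrow> 'v list) \<Rightarrow> ('v set multiset list \<Rightarrow> 'v set \<Rightarrow> 'v) \<Rightarrow> 'v set spmf" where
  "hmp G pr Sr k \<epsilon> N est = (\<lambda>(\<epsilon>11, \<epsilon>12) ord sel.
    bind_pmf est (\<lambda>OPT\<^sub>L.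
      if OPT\<^sub>L > 0
      then
        let n = card (pverts G);
            l = nat \<lceil>max (l1 n k N \<epsilon> \<epsilon>11) (l2 n N \<epsilon>12) / OPT\<^sub>L\<rceil>
        in map_spmf (greedy sel k) (replicate_spmf l (r_sample G pr Sr ord))
      else return_pmf None))"

end

theory Submission
  imports Defs
begin

text \<open>In the live subgraph a node \<open>v\<close> reached by the misinformation is protected by \<open>S\<close> iff some node
  of \<open>S\<close> is strictly closer to \<open>v\<close> than \<open>Sr\<close> is, and the set returned by the reverse step consists of
  exactly these closer nodes. By deferred decisions, an R-sample is a deterministic function of a full
  realization, so \<open>x_cov\<close> is an unbiased estimator of \<open>f_star\<close> with values in \<open>[0, n]\<close>. The Chernoff
  lower tail at the optimum and the upper tail for each of the \<open>n choose k\<close> candidate solutions each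
  fail with probability at most \<open>1 / N\<close>. Coverage is monotone and submodular, so greedy loses a factor
  \<open>1 - 1 / e\<close> on the sample, and the equation for \<open>\<epsilon>11, \<epsilon>12\<close> turns the two deviations
  into \<open>\<epsilon>\<close>.\<close>

section \<open>Diffusion and distances in the live subgraph\<close>

text \<open>The bound on the length is strict, so that \<open>walk_lt L 0\<close> is empty and the
  nodes strictly closer than \<open>n\<close> to \<open>v\<close> are those related to
  \<open>v\<close> by \<open>walk_lt L n\<close>.\<close>

definition walk_lt :: "('a \<times> 'a) set \<Rightarrow> nat \<Rightarrow> ('a \<times> 'a) set" where
  "walk_lt L n = (\<Union>m<n. L ^^ m)"

lemma walk_lt_0 [simp]: "walk_lt L 0 = {}"
  by (simp add: walk_lt_def)

lemma walk_lt_Suc: "walk_lt L (Suc n) = Id \<union> walk_lt L n O L"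
  by (auto simp: walk_lt_def lessThan_Suc_eq_insert_0)

text \<open>Peels off the first edge, as the search backwards from a node does;
  \<open>walk_lt_Suc\<close> peels off the last edge, as the diffusion does.\<close>

lemma walk_lt_Suc': "walk_lt L (Suc n) = Id \<union> L O walk_lt L n"
proof -
  have "walk_lt L n O L = L O walk_lt L n" for n
    by (simp add: walk_lt_def relcomp_UNION_distrib relcomp_UNION_distrib2 relpow_commute)
  then show ?thesis by (simp add: walk_lt_Suc)
qed

lemma walk_lt_mono: "m \<le> n \<Longrightarrow> walk_lt L m \<subseteq> walk_lt L n"
  unfolding walk_lt_def by (rule UN_mono) auto

lemma rtrancl_iff_walk_lt: "(x, y) \<in> L\<^sup>* \<longleftrightarrow> (\<exists>n. (x, y) \<in> walk_lt L n)"
  by (auto simp: walk_lt_def rtrancl_power)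

text \<open>A shortest walk is no longer than the number of edges. This bounds the number of rounds
  of the reverse search.\<close>

lemma rtrancl_subset_walk_lt:
  assumes "finite E" "L \<subseteq> E"
  shows "L\<^sup>* \<subseteq> walk_lt L (Suc (card E))"
proof -
  have "finite L" "card L \<le> card E" using assms finite_subset card_mono by auto
  then show ?thesis
    unfolding rtrancl_finite_eq_relpow[OF \<open>finite L\<close>] walk_lt_def by (intro UN_mono) auto
qed

section \<open>Rounds of the diffusion as distance classes\<close>

definition live :: "('v \<times> 'v) set \<Rightarrow> ('v \<times> 'v \<Rightarrow> bool) \<Rightarrow> ('v \<times> 'v) set" where
  "live E g = {e \<in> E. g e}"

text \<open>Each cascade spreads along shortest live walks: blocking can only happen at nodes that
  the other cascade reaches in time, and these pass the activation on just as fast. So the frontiers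
  at time \<open>t\<close> are differences of the balls \<open>r\<close> and \<open>p\<close>, which
  ignore the competing cascade. The priority of the misinformation is the asymmetry between
  \<open>p t\<close> and \<open>r (Suc t)\<close> in the subtracted sets.\<close>

lemma diffusion_eq:
  fixes G :: "'v pair_pre_digraph" and g :: "'v \<times> 'v \<Rightarrow> bool" and Sr S :: "'v set"
  assumes wf: "parcs G \<subseteq> pverts G \<times> pverts G"
  defines "L \<equiv> live (parcs G) g"
  defines "r \<equiv> \<lambda>n. walk_lt L n `` Sr" and "p \<equiv> \<lambda>n. walk_lt L n `` (S - Sr)"
  shows "\<exists>R P. diffusion G g Sr S t = (R, P, r (Suc t) - r t - p t, p (Suc t) - p t - r (Suc t))
    \<and> R \<union> P = r (Suc t) \<union> p (Suc t) \<and> R = (\<Union>m\<le>t. r (Suc m) - r m - p m)"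
proof (induction t)
  case 0
  show ?case by (auto simp: r_def p_def walk_lt_Suc)
next
  case (Suc t)
  have rS: "r (Suc n) = Sr \<union> L `` r n" and pS: "p (Suc n) = (S - Sr) \<union> L `` p n" for n
    by (auto simp: r_def p_def walk_lt_Suc)
  have mono: "r t \<subseteq> r (Suc t)" "p t \<subseteq> p (Suc t)" "r (Suc t) \<subseteq> r (Suc (Suc t))" "p (Suc t) \<subseteq> p (Suc (Suc t))"
    using walk_lt_mono[of t "Suc t" L] walk_lt_mono[of "Suc t" "Suc (Suc t)" L] by (auto simp: r_def p_def)
  have init: "Sr \<subseteq> r (Suc t)" "S - Sr \<subseteq> p (Suc t)" by (auto simp: rS pS)
  obtain R P where IH: "diffusion G g Sr S t = (R, P, r (Suc t) - r t - p t, p (Suc t) - p t - r (Suc t))"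
    "R \<union> P = r (Suc t) \<union> p (Suc t)" "R = (\<Union>m\<le>t. r (Suc m) - r m - p m)"
    using Suc by blast
  define DR where "DR = r (Suc t) - r t - p t"
  define DP where "DP = p (Suc t) - p t - r (Suc t)"
  define New where "New = {v \<in> pverts G - (R \<union> P). \<exists>u \<in> DR \<union> DP. (u, v) \<in> parcs G \<and> g (u, v)}"
  define NewR where "NewR = {v \<in> New. \<exists>u \<in> DR. (u, v) \<in> parcs G \<and> g (u, v)}"
  have New: "New = L `` (DR \<union> DP) - (r (Suc t) \<union> p (Suc t))"
    unfolding New_def IH(2) using wf by (auto simp: L_def live_def)
  have NewR': "NewR = L `` DR - (r (Suc t) \<union> p (Suc t))"
    unfolding NewR_def New by (auto simp: L_def live_def)
  have NewR: "NewR = r (Suc (Suc t)) - r (Suc t) - p (Suc t)"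
  proof (intro equalityI subsetI)
    fix v assume "v \<in> NewR"
    then show "v \<in> r (Suc (Suc t)) - r (Suc t) - p (Suc t)"
      unfolding NewR' DR_def rS[of "Suc t"] by auto
  next
    fix v assume v: "v \<in> r (Suc (Suc t)) - r (Suc t) - p (Suc t)"
    then obtain u where u: "u \<in> r (Suc t)" "(u, v) \<in> L"
      using init unfolding rS[of "Suc t"] by auto
    \<comment> \<open>If the predecessor \<open>u\<close> lay in \<open>r t\<close> or
      \<open>p t\<close>, then \<open>v\<close> would lie in \<open>r (Suc t)\<close> or
      \<open>p (Suc t)\<close>; hence \<open>u\<close> is in the current frontier.\<close>
    have "u \<notin> r t" using u v rS[of t] by auto
    moreover have "u \<notin> p t" using u v pS[of t] by auto
    ultimately show "v \<in> NewR" using u v unfolding NewR' DR_def by auto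
  qed
  have NewP: "New - NewR = p (Suc (Suc t)) - p (Suc t) - r (Suc (Suc t))"
  proof (intro equalityI subsetI)
    fix v assume v: "v \<in> New - NewR"
    then have "v \<in> L `` DP" "v \<notin> p (Suc t)" "v \<notin> r (Suc t)" unfolding NewR' New by auto
    moreover from this v have "v \<notin> r (Suc (Suc t))" unfolding NewR by auto
    ultimately show "v \<in> p (Suc (Suc t)) - p (Suc t) - r (Suc (Suc t))"
      unfolding DP_def pS[of "Suc t"] by auto
  next
    fix v assume v: "v \<in> p (Suc (Suc t)) - p (Suc t) - r (Suc (Suc t))"
    then obtain u where u: "u \<in> p (Suc t)" "(u, v) \<in> L"
      using init unfolding pS[of "Suc t"] by auto
    have "u \<notin> p t" using u v pS[of t] by auto
    moreover have "u \<notin> r (Suc t)" using u v rS[of "Suc t"] by auto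
    ultimately have "v \<in> New" using u v mono unfolding New DP_def by auto
    then show "v \<in> New - NewR" using v NewR by auto
  qed
  have "diffusion G g Sr S (Suc t) = (R \<union> NewR, P \<union> (New - NewR), NewR, New - NewR)"
    unfolding diffusion.simps IH(1) Let_def prod.case DR_def[symmetric] DP_def[symmetric]
      New_def[symmetric] NewR_def[symmetric] ..
  then have "diffusion G g Sr S (Suc t) = (R \<union> NewR, P \<union> (New - NewR),
      r (Suc (Suc t)) - r (Suc t) - p (Suc t), p (Suc (Suc t)) - p (Suc t) - r (Suc (Suc t)))"
    unfolding NewR[symmetric] NewP[symmetric] .
  moreover have "R \<union> NewR = (\<Union>m\<le>Suc t. r (Suc m) - r m - p m)"
    unfolding IH(3) NewR by (auto simp: atMost_Suc)
  moreover have "(R \<union> NewR) \<union> (P \<union> (New - NewR)) = r (Suc (Suc t)) \<union> p (Suc (Suc t))"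
  proof -
    have "(R \<union> NewR) \<union> (P \<union> (New - NewR)) = (R \<union> P) \<union> NewR \<union> (New - NewR)" by blast
    also have "\<dots> = r (Suc (Suc t)) \<union> p (Suc (Suc t))"
      unfolding IH(2) NewP unfolding NewR using mono(3,4) by auto
    finally show ?thesis .
  qed
  ultimately show ?case by blast
qed

text \<open>\<open>hit L X v\<close> is the distance from \<open>X\<close> to \<open>v\<close>, and \<open>closer L X v\<close> is the set that the reverse
  step returns for \<open>v\<close>. Both are junk if \<open>v\<close> cannot be reached from \<open>X\<close>.\<close>

definition hit :: "('v \<times> 'v) set \<Rightarrow> 'v set \<Rightarrow> 'v \<Rightarrow> nat" where
  "hit L X v = (LEAST n. v \<in> walk_lt L (Suc n) `` X)"

definition closer :: "('v \<times> 'v) set \<Rightarrow> 'v set \<Rightarrow> 'v \<Rightarrow> 'v set" where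
  "closer L X v = {u. (u, v) \<in> walk_lt L (hit L X v)}"

lemma hit_eqI:
  assumes "v \<in> walk_lt L (Suc n) `` X" "v \<notin> walk_lt L n `` X"
  shows "hit L X v = n"
  unfolding hit_def
proof (rule Least_equality)
  fix m assume m: "v \<in> walk_lt L (Suc m) `` X"
  show "n \<le> m"
  proof (rule ccontr)
    assume "\<not> n \<le> m"
    then have "walk_lt L (Suc m) \<subseteq> walk_lt L n" by (intro walk_lt_mono) simp
    then show False using m assms(2) by (meson Image_mono subsetD subset_refl)
  qed
qed (fact assms(1))

lemma hit_works:
  assumes "v \<in> L\<^sup>* `` X"
  shows "v \<in> walk_lt L (Suc (hit L X v)) `` X" "v \<notin> walk_lt L (hit L X v) `` X"
proof -
  obtain x where x: "x \<in> X" "(x, v) \<in> L\<^sup>*" using assms by auto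
  then obtain n where "(x, v) \<in> walk_lt L n" unfolding rtrancl_iff_walk_lt by auto
  then have "(x, v) \<in> walk_lt L (Suc n)" using walk_lt_mono[of n "Suc n" L] by auto
  then have "v \<in> walk_lt L (Suc n) `` X" using x by auto
  then show "v \<in> walk_lt L (Suc (hit L X v)) `` X" unfolding hit_def by (rule LeastI)
  show "v \<notin> walk_lt L (hit L X v) `` X"
  proof
    assume a: "v \<in> walk_lt L (hit L X v) `` X"
    show False
    proof (cases "hit L X v")
      case 0
      then show False using a by simp
    next
      case (Suc m)
      then have "v \<in> walk_lt L (Suc m) `` X" using a by simp
      then have "hit L X v \<le> m" unfolding hit_def by (rule Least_le)
      then show False using Suc by simp
    qed
  qed
qed

text \<open>The only round in which \<open>v\<close> can be misinformed is its distance from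
  \<open>Sr\<close>, and this fails exactly when some node of \<open>S - Sr\<close> is strictly
  closer.\<close>

lemma never_misinformed_iff:
  fixes G :: "'v pair_pre_digraph" and g :: "'v \<times> 'v \<Rightarrow> bool" and Sr S :: "'v set"
  assumes wf: "parcs G \<subseteq> pverts G \<times> pverts G"
  defines "L \<equiv> live (parcs G) g"
  assumes v: "v \<in> pverts G"
  shows "v \<in> never_misinformed G g Sr S \<longleftrightarrow> v \<in> L\<^sup>* `` Sr \<longrightarrow> closer L Sr v \<inter> S \<noteq> {}"
proof -
  have "fst (diffusion G g Sr S t)
      = (\<Union>m\<le>t. walk_lt L (Suc m) `` Sr - walk_lt L m `` Sr - walk_lt L m `` (S - Sr))" for t
  proof -
    obtain R P D where "diffusion G g Sr S t = (R, P, D)"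
      "R = (\<Union>m\<le>t. walk_lt L (Suc m) `` Sr - walk_lt L m `` Sr - walk_lt L m `` (S - Sr))"
      using diffusion_eq[OF wf, of g Sr S t] unfolding L_def by blast
    then show ?thesis by simp
  qed
  then have iff: "v \<in> never_misinformed G g Sr S \<longleftrightarrow>
      (\<forall>m. v \<in> walk_lt L (Suc m) `` Sr \<and> v \<notin> walk_lt L m `` Sr \<longrightarrow> v \<in> walk_lt L m `` (S - Sr))"
    using v unfolding never_misinformed_def by blast
  show ?thesis
  proof (cases "v \<in> L\<^sup>* `` Sr")
    case True
    have "v \<in> walk_lt L (Suc m) `` Sr \<and> v \<notin> walk_lt L m `` Sr \<longleftrightarrow> m = hit L Sr v" for m
      using hit_works[OF True] hit_eqI[of v L m Sr] by auto
    then have "v \<in> never_misinformed G g Sr S \<longleftrightarrow> v \<in> walk_lt L (hit L Sr v) `` (S - Sr)"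
      unfolding iff by simp
    \<comment> \<open>No node of \<open>Sr\<close> is strictly closer to \<open>v\<close> than the
      distance from \<open>Sr\<close>, so \<open>S - Sr\<close> may be replaced by
      \<open>S\<close>.\<close>
    also have "\<dots> \<longleftrightarrow> closer L Sr v \<inter> S \<noteq> {}"
      using hit_works(2)[OF True] unfolding closer_def by blast
    finally show ?thesis using True by simp
  next
    case False
    then have "v \<notin> walk_lt L m `` Sr" for m using rtrancl_iff_walk_lt[of _ v L] by blast
    then show ?thesis using False by (simp add: iff)
  qed
qed

section \<open>Counting the protected nodes\<close>

lemma rtrancl_Image_subset:
  assumes "L \<subseteq> V \<times> V" "X \<subseteq> V"
  shows "L\<^sup>* `` X \<subseteq> V"
proof
  fix v assume "v \<in> L\<^sup>* `` X"
  then obtain x where "x \<in> X" "(x, v) \<in> L\<^sup>*" by blast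
  from this(2,1) show "v \<in> V" using assms by (induction rule: rtrancl_induct) auto
qed

text \<open>Nodes that the misinformation cannot reach are counted by both cardinalities and cancel;
  with no positive seeds every reached node is misinformed. What remains are the reached nodes whose
  closer set meets \<open>S\<close>.\<close>

lemma card_never_misinformed_diff:
  fixes G :: "'v pair_pre_digraph" and g :: "'v \<times> 'v \<Rightarrow> bool" and Sr S :: "'v set"
  assumes fin: "finite (pverts G)" and wf: "parcs G \<subseteq> pverts G \<times> pverts G" and Sr: "Sr \<subseteq> pverts G"
  defines "L \<equiv> live (parcs G) g"
  shows "real (card (never_misinformed G g Sr S)) - real (card (never_misinformed G g Sr {}))
    = (\<Sum>v\<in>L\<^sup>* `` Sr. y_cov (closer L Sr v) S)"
proof -
  define Vr where "Vr = L\<^sup>* `` Sr"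
  have Vr: "Vr \<subseteq> pverts G" unfolding Vr_def
    using wf Sr by (intro rtrancl_Image_subset) (auto simp: L_def live_def)
  have eq: "never_misinformed G g Sr S = (pverts G - Vr) \<union> {v \<in> Vr. closer L Sr v \<inter> S \<noteq> {}}" for S
  proof (rule set_eqI)
    fix v
    show "v \<in> never_misinformed G g Sr S \<longleftrightarrow> v \<in> (pverts G - Vr) \<union> {v \<in> Vr. closer L Sr v \<inter> S \<noteq> {}}"
      using never_misinformed_iff[OF wf, of v g Sr S] Vr unfolding L_def[symmetric] Vr_def[symmetric]
      by (cases "v \<in> pverts G") (auto simp: never_misinformed_def)
  qed
  have "card (never_misinformed G g Sr S) = card (pverts G - Vr) + card {v \<in> Vr. closer L Sr v \<inter> S \<noteq> {}}" for S
    unfolding eq using fin Vr finite_subset[OF Vr fin] by (intro card_Un_disjoint) auto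
  then have "real (card (never_misinformed G g Sr S)) - real (card (never_misinformed G g Sr {}))
     = real (card {v \<in> Vr. closer L Sr v \<inter> S \<noteq> {}})" by simp
  also have "\<dots> = (\<Sum>v\<in>Vr. y_cov (closer L Sr v) S)"
    using finite_subset[OF Vr fin] by (simp add: y_cov_def sum.If_cases Int_def)
  finally show ?thesis unfolding Vr_def .
qed

section \<open>R-samples as functions of a full realization\<close>

text \<open>The law of the full realization conditioned on the states sampled so far.\<close>

definition completion ::
  "('v \<times> 'v) set \<Rightarrow> 'v prob_fun \<Rightarrow> 'v edge_states \<Rightarrow> ('v \<times> 'v \<Rightarrow> bool) pmf" where
  "completion E pr st = map_pmf (\<lambda>g e. case st e of None \<Rightarrow> g e | Some b \<Rightarrow> b)
    (Pi_pmf {e \<in> E. st e = None} False (\<lambda>e. bernoulli_pmf (pr e)))"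

lemma completion_empty: "completion (parcs G) pr Map.empty = realization G pr"
  by (simp add: completion_def realization_def)

text \<open>Edge states are independent, so the product law on the unknown edges splits into the
  part on \<open>F\<close> and the rest: revealing \<open>F\<close> first and completing afterwards
  gives the same law as completing at once.\<close>

lemma bind_sample_edges_completion:
  assumes "finite E" "F \<subseteq> E"
  shows "bind_pmf (sample_edges pr F st) (completion E pr) = completion E pr st"
proof -
  define A where "A = {e \<in> F. st e = None}"
  define B where "B = {e \<in> E. st e = None} - A"
  define upd where "upd = (\<lambda>g e. if e \<in> F \<and> st e = None then Some (g e) else st e)"
  let ?Pi = "\<lambda>A. Pi_pmf A False (\<lambda>e. bernoulli_pmf (pr e))"
  \<comment> \<open>The set of edges left unknown does not depend on the outcome on
    \<open>A\<close>, so the second draw is independent of the first.\<close>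
  have B: "{e \<in> E. upd g e = None} = B" for g by (auto simp: B_def A_def upd_def)
  have AB: "A \<union> B = {e \<in> E. st e = None}" using assms by (auto simp: A_def B_def)
  have fin: "finite A" "finite B" "A \<inter> B = {}"
    using assms finite_subset[of F E] by (auto simp: A_def B_def)
  have "bind_pmf (sample_edges pr F st) (completion E pr)
      = bind_pmf (?Pi A) (\<lambda>g. map_pmf (\<lambda>g' e. case upd g e of None \<Rightarrow> g' e | Some b \<Rightarrow> b) (?Pi B))"
    unfolding sample_edges_def A_def[symmetric] upd_def[symmetric] bind_map_pmf completion_def B ..
  also have "\<dots> = map_pmf (\<lambda>(g, g') e. case upd g e of None \<Rightarrow> g' e | Some b \<Rightarrow> b) (pair_pmf (?Pi A) (?Pi B))"
    by (simp add: pair_pmf_def map_pmf_def bind_assoc_pmf bind_return_pmf)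
  also have "\<dots> = map_pmf (\<lambda>h e. case st e of None \<Rightarrow> h e | Some b \<Rightarrow> b)
      (map_pmf (\<lambda>(f, g) x. if x \<in> A then f x else g x) (pair_pmf (?Pi A) (?Pi B)))"
    unfolding pmf.map_comp
    by (intro map_pmf_cong refl) (auto simp: upd_def A_def fun_eq_iff split: option.splits)
  also have "\<dots> = completion E pr st"
    unfolding completion_def AB[symmetric] Pi_pmf_union[OF fin] ..
  finally show ?thesis .
qed

text \<open>Lets an invariant that holds for all completions of \<open>st\<close> be inherited by
  every later state of the search.\<close>

lemma set_completion_sample_edges:
  assumes "finite E" "F \<subseteq> E" "st' \<in> set_pmf (sample_edges pr F st)" "g \<in> set_pmf (completion E pr st')"
  shows "g \<in> set_pmf (completion E pr st)"
  using assms(3,4) unfolding bind_sample_edges_completion[OF assms(1,2), of pr st, symmetric] by auto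

text \<open>After the sampling no edge of \<open>F\<close> is unknown, and a completion keeps known
  states. Hence a frontier computed from \<open>st'\<close> can be read off
  \<open>g\<close>.\<close>

lemma sample_edges_agrees:
  assumes "st' \<in> set_pmf (sample_edges pr F st)" "g \<in> set_pmf (completion E pr st')" "e \<in> F"
  shows "st' e = Some True \<longleftrightarrow> g e"
proof -
  have "st' e \<noteq> None" using assms(1,3) by (auto simp: sample_edges_def)
  then show ?thesis using assms(2) by (auto simp: completion_def)
qed

section \<open>Joint laws of a result and the completed realization\<close>

lemma bind_spmf_bind_pmf: "bind_spmf (bind_pmf p f) h = bind_pmf p (\<lambda>x. bind_spmf (f x) h)"
  by (simp add: bind_spmf_def bind_assoc_pmf)

lemma joint_set:
  assumes J: "bind_spmf p (\<lambda>(a, st). map_pmf (\<lambda>g. Some (a, g)) (c st)) = map_pmf (\<lambda>g. Some (F g, g)) q"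
    and "(a, st) \<in> set_spmf p" "g \<in> set_pmf (c st)"
  shows "g \<in> set_pmf q" "a = F g"
proof -
  have "(a, g) \<in> set_spmf (bind_spmf p (\<lambda>(a, st). map_pmf (\<lambda>g. Some (a, g)) (c st)))"
    using assms(2,3) by (force simp: set_bind_spmf in_set_spmf)
  then show "g \<in> set_pmf q" "a = F g" unfolding J by (auto simp: in_set_spmf)
qed

text \<open>Chains two sampling phases: when the second phase, started in \<open>st\<close>, is a
  function of a completion of \<open>st\<close>, the composition is a function of one single
  realization drawn from \<open>q\<close>.\<close>

lemma joint_bind:
  assumes J: "bind_spmf p (\<lambda>(a, st). map_pmf (\<lambda>g. Some (a, g)) (c st)) = map_pmf (\<lambda>g. Some (F g, g)) q"
    and k: "\<And>a st. (a, st) \<in> set_spmf p \<Longrightarrow> k a st = map_pmf (\<lambda>g. Some (h a g)) (c st)"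
  shows "bind_spmf p (\<lambda>(a, st). k a st) = map_pmf (\<lambda>g. Some (h (F g) g)) q"
proof -
  have "bind_spmf p (\<lambda>(a, st). k a st)
     = bind_spmf p (\<lambda>x. map_spmf (\<lambda>(a, g). h a g) (case x of (a, st) \<Rightarrow> map_pmf (\<lambda>g. Some (a, g)) (c st)))"
    using k by (intro bind_spmf_cong refl) (auto simp: pmf.map_comp o_def)
  also have "\<dots> = map_spmf (\<lambda>(a, g). h a g) (map_pmf (\<lambda>g. Some (F g, g)) q)"
    unfolding J[symmetric] map_spmf_bind_spmf o_def ..
  also have "\<dots> = map_pmf (\<lambda>g. Some (h (F g) g)) q"
    by (simp add: pmf.map_comp o_def)
  finally show ?thesis .
qed

text \<open>Keeping the completed realization next to the result lets one reason about the result for a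
  fixed realization and forget the sampled states.\<close>

lemma forward_step_joint:
  fixes G :: "'v pair_pre_digraph" and pr :: "'v prob_fun"
  defines "E \<equiv> parcs G"
  assumes V: "finite (pverts G)" and E: "finite E" "E \<subseteq> pverts G \<times> pverts G"
    and "D \<subseteq> A" "A \<subseteq> pverts G"
    and "\<And>g. g \<in> set_pmf (completion E pr st) \<Longrightarrow> live E g `` (A - D) \<subseteq> A"
  shows "bind_spmf (forward_step G pr A D st) (\<lambda>(A', st'). map_pmf (\<lambda>g. Some (A', g)) (completion E pr st'))
    = map_pmf (\<lambda>g. Some ((live E g)\<^sup>* `` A, g)) (completion E pr st)"
  using assms(5-)
proof (induction "card (pverts G - A)" arbitrary: A D st rule: less_induct)
  case less
  \<comment> \<open>Treated apart from the induction because a round without new nodes does not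
    decrease \<open>card (pverts G - A)\<close>; the next call then ends at once.\<close>
  have base: "bind_spmf (forward_step G pr A {} st) (\<lambda>(A', st'). map_pmf (\<lambda>g. Some (A', g)) (completion E pr st'))
    = map_pmf (\<lambda>g. Some ((live E g)\<^sup>* `` A, g)) (completion E pr st)"
    if "\<And>g. g \<in> set_pmf (completion E pr st) \<Longrightarrow> live E g `` A \<subseteq> A" for st
  proof -
    have "(live E g)\<^sup>* `` A = A" if "g \<in> set_pmf (completion E pr st)" for g
      using Image_closed_trancl[OF \<open>\<And>g. g \<in> set_pmf (completion E pr st) \<Longrightarrow> live E g `` A \<subseteq> A\<close>[OF that]] .
    then show ?thesis
      by (subst forward_step.simps) (auto intro!: map_pmf_cong simp del: Image_closed_trancl)
  qed
  show ?case
  proof (cases "D = {}")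
    case True
    then show ?thesis using base less.prems(3) by simp
  next
    case False
    define F where "F = {(u, v) \<in> E. u \<in> D \<and> v \<in> pverts G - A}"
    define New where "New = (\<lambda>st'. {v \<in> pverts G - A. \<exists>u \<in> D. (u, v) \<in> E \<and> st' (u, v) = Some True})"
    have F: "F \<subseteq> E" by (auto simp: F_def)
    have fs: "forward_step G pr A D st
      = bind_pmf (sample_edges pr F st) (\<lambda>st'. forward_step G pr (A \<union> New st') (New st') st')"
      using False by (subst forward_step.simps) (simp add: F_def New_def E_def Let_def)
    have step: "bind_spmf (forward_step G pr (A \<union> New st') (New st') st')
        (\<lambda>(A', st'). map_pmf (\<lambda>g. Some (A', g)) (completion E pr st'))
      = map_pmf (\<lambda>g. Some ((live E g)\<^sup>* `` A, g)) (completion E pr st')"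
      if st': "st' \<in> set_pmf (sample_edges pr F st)" for st'
    proof -
      have New: "New st' = live E g `` D - A" "live E g `` A \<subseteq> A \<union> New st'"
        if g: "g \<in> set_pmf (completion E pr st')" for g
      proof -
        have "st' e = Some True \<longleftrightarrow> g e" if "e \<in> F" for e
          using sample_edges_agrees[OF st' g that] .
        then show *: "New st' = live E g `` D - A"
          using E by (auto simp: New_def live_def F_def)
        have "live E g `` (A - D) \<subseteq> A"
          using less.prems(3) set_completion_sample_edges[OF E(1) F st' g] .
        \<comment> \<open>By the invariant, live edges out of \<open>A - D\<close> stay in
          \<open>A\<close>; those out of \<open>D\<close> end in \<open>A\<close> or in
          \<open>New st'\<close>.\<close>
        then show "live E g `` A \<subseteq> A \<union> New st'" unfolding * by blast
      qed
      show ?thesis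
      proof (cases "New st' = {}")
        case True
        then show ?thesis using New(2) base[of st'] by simp
      next
        case False
        moreover have "New st' \<subseteq> pverts G - A" by (auto simp: New_def)
        ultimately have "card (pverts G - (A \<union> New st')) < card (pverts G - A)"
          using V by (intro psubset_card_mono) auto
        moreover have "live E g `` (A \<union> New st' - New st') \<subseteq> A \<union> New st'"
          if "g \<in> set_pmf (completion E pr st')" for g using New(2)[OF that] by blast
        ultimately have "bind_spmf (forward_step G pr (A \<union> New st') (New st') st')
            (\<lambda>(A', st'). map_pmf (\<lambda>g. Some (A', g)) (completion E pr st'))
          = map_pmf (\<lambda>g. Some ((live E g)\<^sup>* `` (A \<union> New st'), g)) (completion E pr st')"
          using less.prems(2) \<open>New st' \<subseteq> pverts G - A\<close> by (intro less.hyps) auto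
        also have "\<dots> = map_pmf (\<lambda>g. Some ((live E g)\<^sup>* `` A, g)) (completion E pr st')"
        proof (intro map_pmf_cong refl)
          fix g assume "g \<in> set_pmf (completion E pr st')"
          then have "New st' \<subseteq> (live E g)\<^sup>* `` A" using New(1) less.prems(1) by blast
          then have "(live E g)\<^sup>* `` (A \<union> New st') = (live E g)\<^sup>* `` A"
            by (auto intro: rtrancl_trans)
          then show "Some ((live E g)\<^sup>* `` (A \<union> New st'), g) = Some ((live E g)\<^sup>* `` A, g)" by simp
        qed
        finally show ?thesis .
      qed
    qed
    have "bind_spmf (forward_step G pr A D st) (\<lambda>(A', st'). map_pmf (\<lambda>g. Some (A', g)) (completion E pr st'))
      = bind_pmf (sample_edges pr F st) (\<lambda>st'. map_pmf (\<lambda>g. Some ((live E g)\<^sup>* `` A, g)) (completion E pr st'))"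
      unfolding fs bind_spmf_bind_pmf using step by (intro bind_pmf_cong refl)
    also have "\<dots> = map_pmf (\<lambda>g. Some ((live E g)\<^sup>* `` A, g)) (completion E pr st)"
      unfolding bind_sample_edges_completion[OF E(1) F, of pr st, symmetric] map_bind_pmf ..
    finally show ?thesis .
  qed
qed

text \<open>The assumption that \<open>v\<close> is reached from \<open>Sr\<close> in every completion is what makes the loop
  terminate: otherwise it would run forever with an empty frontier.\<close>

lemma reverse_step_joint:
  fixes G :: "'v pair_pre_digraph" and pr :: "'v prob_fun"
  defines "E \<equiv> parcs G"
  assumes E: "finite E" "E \<subseteq> pverts G \<times> pverts G"
    and "\<And>g. g \<in> set_pmf (completion E pr st) \<Longrightarrow>
      v \<in> (live E g)\<^sup>* `` Sr \<and> v \<notin> walk_lt (live E g) n `` Sr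
      \<and> Q = {u. (u, v) \<in> walk_lt (live E g) (Suc n) - walk_lt (live E g) n}
      \<and> P = {u. (u, v) \<in> walk_lt (live E g) n}"
  shows "bind_spmf (reverse_step G pr Sr Q P st) (\<lambda>(P', st'). map_pmf (\<lambda>g. Some (P', g)) (completion E pr st'))
    = map_pmf (\<lambda>g. Some (closer (live E g) Sr v, g)) (completion E pr st)"
  using assms(4-)
proof (induction "Suc (card E) - n" arbitrary: n Q P st rule: less_induct)
  case less
  note H = less.prems
  show ?case
  proof (cases "Q \<inter> Sr = {}")
    case False
    have "closer (live E g) Sr v = P" if g: "g \<in> set_pmf (completion E pr st)" for g
    proof -
      \<comment> \<open>The frontier \<open>Q\<close> is the class at distance exactly
        \<open>n\<close> to \<open>v\<close>, so a seed in it makes \<open>n\<close> the distance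
        from \<open>Sr\<close>.\<close>
      have "v \<in> walk_lt (live E g) (Suc n) `` Sr" using H[OF g] False by blast
      then have "hit (live E g) Sr v = n" using H[OF g] by (intro hit_eqI) auto
      then show ?thesis using H[OF g] by (simp add: closer_def)
    qed
    then show ?thesis
      using False by (subst reverse_step.simps) (auto intro!: map_pmf_cong)
  next
    case True
    define F where "F = {(u1, u2) \<in> E. u2 \<in> Q \<and> u1 \<in> pverts G - (P \<union> Q)}"
    define Q' where "Q' = (\<lambda>st'. {u1. \<exists>u2. (u1, u2) \<in> F \<and> st' (u1, u2) = Some True})"
    have F: "F \<subseteq> E" by (auto simp: F_def)
    have PQ: "P \<union> Q = {u. (u, v) \<in> walk_lt (live E g) (Suc n)}" "v \<notin> walk_lt (live E g) (Suc n) `` Sr"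
      if "g \<in> set_pmf (completion E pr st)" for g
    proof -
      show *: "P \<union> Q = {u. (u, v) \<in> walk_lt (live E g) (Suc n)}"
        using H[OF that] walk_lt_mono[of n "Suc n" "live E g"] by auto
      show "v \<notin> walk_lt (live E g) (Suc n) `` Sr"
        using H[OF that] True * by blast
    qed
    have rs: "reverse_step G pr Sr Q P st
      = bind_pmf (sample_edges pr F st) (\<lambda>st'. reverse_step G pr Sr (Q' st') (P \<union> Q) st')"
      using True by (subst reverse_step.simps) (simp add: F_def Q'_def E_def Let_def)
    \<comment> \<open>Beyond this bound \<open>walk_lt\<close> contains all reachable pairs, so a
      reachable \<open>v\<close> could not still be missed by \<open>Sr\<close>. This makes the
      induction measure decrease.\<close>
    have n: "n < Suc (card E)"
    proof (rule ccontr)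
      assume n: "\<not> n < Suc (card E)"
      obtain g where g: "g \<in> set_pmf (completion E pr st)" using set_pmf_not_empty by fast
      have "(live E g)\<^sup>* \<subseteq> walk_lt (live E g) n"
        using rtrancl_subset_walk_lt[OF E(1), of "live E g"] walk_lt_mono[of "Suc (card E)" n "live E g"] n
        by (auto simp: live_def)
      then show False using H[OF g] by blast
    qed
    have step: "bind_spmf (reverse_step G pr Sr (Q' st') (P \<union> Q) st')
        (\<lambda>(P', st'). map_pmf (\<lambda>g. Some (P', g)) (completion E pr st'))
      = map_pmf (\<lambda>g. Some (closer (live E g) Sr v, g)) (completion E pr st')"
      if st': "st' \<in> set_pmf (sample_edges pr F st)" for st'
    proof (rule less.hyps)
      show "Suc (card E) - Suc n < Suc (card E) - n" using n by simp
    next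
      fix g assume g': "g \<in> set_pmf (completion E pr st')"
      then have g: "g \<in> set_pmf (completion E pr st)"
        using set_completion_sample_edges[OF E(1) F st'] by blast
      have "st' e = Some True \<longleftrightarrow> g e" if "e \<in> F" for e
        using sample_edges_agrees[OF st' g' that] .
      then have "Q' st' = {u. \<exists>w\<in>Q. (u, w) \<in> live E g \<and> u \<notin> P \<union> Q}"
        using E by (auto simp: Q'_def live_def F_def)
      \<comment> \<open>A node with a live edge into \<open>P\<close> already lies in
        \<open>P \<union> Q\<close>, so the edges into \<open>Q\<close> alone yield the whole next
        distance class.\<close>
      also have "\<dots> = {u. (u, v) \<in> walk_lt (live E g) (Suc (Suc n)) - walk_lt (live E g) (Suc n)}"
        using H[OF g] unfolding PQ(1)[OF g] walk_lt_Suc'[of "live E g"] by blast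
      finally show "v \<in> (live E g)\<^sup>* `` Sr \<and> v \<notin> walk_lt (live E g) (Suc n) `` Sr
        \<and> Q' st' = {u. (u, v) \<in> walk_lt (live E g) (Suc (Suc n)) - walk_lt (live E g) (Suc n)}
        \<and> P \<union> Q = {u. (u, v) \<in> walk_lt (live E g) (Suc n)}"
        using H[OF g] PQ[OF g] by blast
    qed
    have "bind_spmf (reverse_step G pr Sr Q P st) (\<lambda>(P', st'). map_pmf (\<lambda>g. Some (P', g)) (completion E pr st'))
      = bind_pmf (sample_edges pr F st) (\<lambda>st'. map_pmf (\<lambda>g. Some (closer (live E g) Sr v, g)) (completion E pr st'))"
      unfolding rs bind_spmf_bind_pmf using step by (intro bind_pmf_cong refl)
    also have "\<dots> = map_pmf (\<lambda>g. Some (closer (live E g) Sr v, g)) (completion E pr st)"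
      unfolding bind_sample_edges_completion[OF E(1) F, of pr st, symmetric] map_bind_pmf ..
    finally show ?thesis .
  qed
qed

text \<open>The searches share sampled states, yet each one returns the closer set in the same
  completed realization. The joint law carries this realization from one search to the next by
  \<open>joint_bind\<close>.\<close>

lemma reverse_all_eq:
  fixes G :: "'v pair_pre_digraph" and pr :: "'v prob_fun"
  defines "E \<equiv> parcs G"
  assumes E: "finite E" "E \<subseteq> pverts G \<times> pverts G"
    and "\<And>g. g \<in> set_pmf (completion E pr st) \<Longrightarrow> set vs \<subseteq> (live E g)\<^sup>* `` Sr"
  shows "reverse_all G pr Sr vs st
    = map_pmf (\<lambda>g. Some (mset (map (closer (live E g) Sr) vs))) (completion E pr st)"
  using assms(4-)
proof (induction vs arbitrary: st)
  case Nil
  then show ?case by (simp add: map_pmf_const)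
next
  case (Cons v vs)
  \<comment> \<open>The search starts with \<open>n = 0\<close>: \<open>walk_lt\<close> is empty at
    0 and the identity at 1, which matches the initial sets \<open>{}\<close> and
    \<open>{v}\<close>.\<close>
  have J: "bind_spmf (reverse_step G pr Sr {v} {} st) (\<lambda>(P', st'). map_pmf (\<lambda>g. Some (P', g)) (completion E pr st'))
    = map_pmf (\<lambda>g. Some (closer (live E g) Sr v, g)) (completion E pr st)"
    unfolding E_def
    by (rule reverse_step_joint[where n = 0]) (use E Cons.prems in \<open>auto simp: E_def walk_lt_Suc\<close>)
  have "bind_spmf (reverse_step G pr Sr {v} {} st) (\<lambda>(P, st'). map_spmf (add_mset P) (reverse_all G pr Sr vs st'))
    = map_pmf (\<lambda>g. Some (add_mset (closer (live E g) Sr v) (mset (map (closer (live E g) Sr) vs)))) (completion E pr st)"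
  proof (rule joint_bind[OF J])
    fix P st' assume st': "(P, st') \<in> set_spmf (reverse_step G pr Sr {v} {} st)"
    have "reverse_all G pr Sr vs st' = map_pmf (\<lambda>g. Some (mset (map (closer (live E g) Sr) vs))) (completion E pr st')"
      using Cons.prems joint_set(1)[OF J st'] by (intro Cons.IH) force
    then show "map_spmf (add_mset P) (reverse_all G pr Sr vs st')
      = map_pmf (\<lambda>g. Some (add_mset P (mset (map (closer (live E g) Sr) vs)))) (completion E pr st')"
      by (simp add: pmf.map_comp o_def)
  qed
  then show ?case by simp
qed

section \<open>The law of an R-sample\<close>

definition full_sample ::
  "('v \<times> 'v) set \<Rightarrow> 'v set \<Rightarrow> ('v set \<Rightarrow> 'v list) \<Rightarrow> ('v \<times> 'v \<Rightarrow> bool) \<Rightarrow> 'v set multiset" where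
  "full_sample E Sr ord g = mset (map (closer (live E g) Sr) (ord ((live E g)\<^sup>* `` Sr)))"

text \<open>Composes the forward and reverse joint laws from the empty state map, whose completion
  is the full realization. The form \<open>spmf_of_pmf\<close> also records termination with
  probability one.\<close>

lemma r_sample_eq:
  fixes G :: "'v pair_pre_digraph"
  assumes V: "finite (pverts G)" and E: "finite (parcs G)" "parcs G \<subseteq> pverts G \<times> pverts G"
    and Sr: "Sr \<subseteq> pverts G" and ord: "\<And>A. A \<subseteq> pverts G \<Longrightarrow> set (ord A) = A"
  shows "r_sample G pr Sr ord = spmf_of_pmf (map_pmf (full_sample (parcs G) Sr ord) (realization G pr))"
proof -
  let ?L = "live (parcs G)" and ?c = "completion (parcs G) pr"
  have J: "bind_spmf (forward_step G pr Sr Sr Map.empty) (\<lambda>(A', st'). map_pmf (\<lambda>g. Some (A', g)) (?c st'))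
    = map_pmf (\<lambda>g. Some ((?L g)\<^sup>* `` Sr, g)) (?c Map.empty)"
    by (rule forward_step_joint) (use V E Sr in auto)
  have "r_sample G pr Sr ord
    = map_pmf (\<lambda>g. Some (mset (map (closer (?L g) Sr) (ord ((?L g)\<^sup>* `` Sr))))) (?c Map.empty)"
    unfolding r_sample_def
  proof (rule joint_bind[OF J], rule reverse_all_eq[OF E])
    fix A st g
    assume "(A, st) \<in> set_spmf (forward_step G pr Sr Sr Map.empty)" "g \<in> set_pmf (?c st)"
    \<comment> \<open>In every completion of the final states the forward step has found exactly the
      reachable nodes; this is the reachability that the reverse searches require.\<close>
    then have A: "A = (?L g)\<^sup>* `` Sr" by (rule joint_set(2)[OF J])
    have "A \<subseteq> pverts G" unfolding A using E Sr by (intro rtrancl_Image_subset) (auto simp: live_def)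
    then show "set (ord A) \<subseteq> (?L g)\<^sup>* `` Sr" using ord A by simp
  qed
  then show ?thesis
    by (simp add: completion_empty full_sample_def[abs_def] spmf_of_pmf_def pmf.map_comp o_def)
qed

lemma replicate_spmf_of_pmf: "replicate_spmf l (spmf_of_pmf p) = spmf_of_pmf (replicate_pmf l p)"
proof (induction l)
  case (Suc l)
  then show ?case
    by (simp add: spmf_of_pmf_def bind_spmf_def bind_map_pmf map_bind_pmf pmf.map_comp o_def map_pmf_def[symmetric])
qed (simp add: spmf_of_pmf_def)

section \<open>Chernoff bounds\<close>

lemma expectation_bind_finite_pmf:
  fixes f :: "'b \<Rightarrow> real"
  assumes "finite (set_pmf p)" "\<And>x. x \<in> set_pmf p \<Longrightarrow> finite (set_pmf (q x))"
  shows "measure_pmf.expectation (bind_pmf p q) f = measure_pmf.expectation p (\<lambda>x. measure_pmf.expectation (q x) f)"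
proof -
  have "measure_pmf.expectation (bind_pmf p q) f = (\<Sum>x\<in>set_pmf p. pmf p x *\<^sub>R measure_pmf.expectation (q x) f)"
    using assms by (intro pmf_expectation_bind) auto
  also have "\<dots> = measure_pmf.expectation p (\<lambda>x. measure_pmf.expectation (q x) f)"
    using assms by (intro integral_measure_pmf[symmetric]) auto
  finally show ?thesis .
qed

lemma mgf_sum_list_replicate_pmf:
  fixes X :: "'a \<Rightarrow> real"
  assumes "finite (set_pmf p)"
  shows "measure_pmf.expectation (replicate_pmf l p) (\<lambda>xs. exp (s * (\<Sum>x\<leftarrow>xs. X x)))
    = measure_pmf.expectation p (\<lambda>x. exp (s * X x)) ^ l"
proof (induction l)
  case (Suc l)
  have fin: "finite (set_pmf (replicate_pmf l p))"
    using finite_lists_length_eq[of "set_pmf p" l] assms by (simp add: set_replicate_pmf lists_eq_set conj_commute)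
  show ?case
    using fin assms
    by (simp add: expectation_bind_finite_pmf Suc exp_add distrib_left)
qed simp

text \<open>Markov's inequality for the exponential of the sum. Keeping the factor \<open>s\<close>
  inside the event leaves its sign free, so that one bound serves both tails.\<close>

lemma sum_list_replicate_pmf_tail:
  fixes X :: "'a \<Rightarrow> real"
  assumes fin: "finite (set_pmf p)"
    and X: "\<And>x. x \<in> set_pmf p \<Longrightarrow> 0 \<le> X x \<and> X x \<le> 1"
  defines "\<mu> \<equiv> measure_pmf.expectation p X"
  shows "measure_pmf.prob (replicate_pmf l p) {xs. s * (\<Sum>x\<leftarrow>xs. X x) \<ge> c}
    \<le> exp (real l * (\<mu> * (exp s - 1)) - c)"
proof -
  let ?q = "replicate_pmf l p" and ?f = "\<lambda>xs. s * (\<Sum>x\<leftarrow>xs. X x)"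
  have finq: "finite (set_pmf ?q)"
    using finite_lists_length_eq[of "set_pmf p" l] fin by (simp add: set_replicate_pmf lists_eq_set conj_commute)
  have "measure_pmf.expectation p (\<lambda>x. exp (s * X x)) \<le> measure_pmf.expectation p (\<lambda>x. 1 + X x * (exp s - 1))"
  proof (intro integral_mono_AE integrable_measure_pmf_finite fin, rule AE_pmfI)
    fix x assume "x \<in> set_pmf p"
    then have x: "0 \<le> X x" "X x \<le> 1" using X by auto
    \<comment> \<open>By convexity \<open>exp (s * x)\<close> lies below its chord over the interval
      from 0 to 1.\<close>
    have "exp ((1 - X x) *\<^sub>R 0 + X x *\<^sub>R s) \<le> (1 - X x) * exp 0 + X x * exp s"
      using x by (intro convex_onD[OF exp_convex]) auto
    then show "exp (s * X x) \<le> 1 + X x * (exp s - 1)" by (simp add: algebra_simps)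
  qed
  also have "\<dots> = 1 + \<mu> * (exp s - 1)"
    using fin by (simp add: integrable_measure_pmf_finite \<mu>_def)
  also have "\<dots> \<le> exp (\<mu> * (exp s - 1))"
    by simp
  finally have mgf: "measure_pmf.expectation p (\<lambda>x. exp (s * X x)) \<le> exp (\<mu> * (exp s - 1))" .
  have "measure_pmf.prob ?q {xs. ?f xs \<ge> c} = measure_pmf.expectation ?q (indicator {xs. ?f xs \<ge> c})"
    by simp
  also have "\<dots> \<le> measure_pmf.expectation ?q (\<lambda>xs. exp (- c) * exp (?f xs))"
    by (intro integral_mono integrable_measure_pmf_finite finq) (auto simp: indicator_def simp flip: exp_add)
  also have "\<dots> = exp (- c) * measure_pmf.expectation p (\<lambda>x. exp (s * X x)) ^ l"
    by (simp add: mgf_sum_list_replicate_pmf fin)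
  also have "\<dots> \<le> exp (- c) * exp (\<mu> * (exp s - 1)) ^ l"
    using mgf by (intro mult_left_mono power_mono) auto
  also have "\<dots> = exp (real l * (\<mu> * (exp s - 1)) - c)"
    by (simp flip: exp_of_nat_mult exp_add add: mult.assoc)
  finally show ?thesis .
qed

text \<open>Both sides agree at 0 and the derivative of the difference is nonnegative. The bound
  brings the optimal Chernoff exponent into rational form.\<close>

lemma ln_add_one_lower_bound:
  fixes x :: real
  assumes "x \<ge> 0"
  shows "2 * x / (2 + x) \<le> ln (1 + x)"
proof -
  let ?f = "\<lambda>x::real. ln (1 + x) - 2 * x / (2 + x)"
  have "?f 0 \<le> ?f x"
  proof (rule DERIV_nonneg_imp_nondecreasing[OF assms])
    fix y :: real assume "0 \<le> y" "y \<le> x"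
    then have "(?f has_real_derivative (1 / (1 + y) - 4 / (2 + y)\<^sup>2)) (at y)"
      by (auto intro!: derivative_eq_intros simp: field_simps power2_eq_square)
    moreover have "4 / (2 + y)\<^sup>2 \<le> 1 / (1 + y)"
    proof -
      have "4 * (1 + y) \<le> (2 + y)\<^sup>2" by (simp add: power2_eq_square algebra_simps)
      then have "4 / (2 + y)\<^sup>2 \<le> 4 / (4 * (1 + y))" using \<open>0 \<le> y\<close> by (intro divide_left_mono) auto
      also have "\<dots> = (4 * 1) / (4 * (1 + y))" by (simp only: mult_1_right)
      also have "\<dots> = 1 / (1 + y)" by (rule mult_divide_mult_cancel_left) simp
      finally show ?thesis .
    qed
    ultimately show "\<exists>D. (?f has_real_derivative D) (at y) \<and> 0 \<le> D" by force
  qed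
  then show ?thesis by simp
qed

text \<open>The deviation \<open>d\<close> is additive, so that the bound also serves candidates
  whose mean is small or zero.\<close>

lemma sum_list_replicate_pmf_upper_tail:
  fixes X :: "'a \<Rightarrow> real"
  assumes fin: "finite (set_pmf p)"
    and X: "\<And>x. x \<in> set_pmf p \<Longrightarrow> 0 \<le> X x \<and> X x \<le> 1"
    and d: "d > 0"
  defines "\<mu> \<equiv> measure_pmf.expectation p X"
  shows "measure_pmf.prob (replicate_pmf l p) {xs. (\<Sum>x\<leftarrow>xs. X x) \<ge> real l * (\<mu> + d)}
    \<le> exp (- (real l * d\<^sup>2 / (2 * \<mu> + d)))"
proof -
  have \<mu>: "\<mu> \<ge> 0" unfolding \<mu>_def using X by (intro integral_nonneg_AE AE_pmfI) auto
  have "\<exists>s>0. \<mu> * (exp s - 1) - s * (\<mu> + d) \<le> - (d\<^sup>2 / (2 * \<mu> + d))"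
  proof (cases "\<mu> = 0")
    case True
    then show ?thesis using d by (intro exI[of _ 1]) (simp add: power2_eq_square)
  next
    case False
    then have \<mu>: "\<mu> > 0" using \<mu> by simp
    \<comment> \<open>This \<open>s\<close> minimises
      \<open>\<mu> * (exp s - 1) - s * (\<mu> + d)\<close>.\<close>
    define s where "s = ln (1 + d / \<mu>)"
    have e: "\<mu> * (exp s - 1) = d" unfolding s_def using \<mu> d by (simp add: add_pos_pos)
    have "2 * (d / \<mu>) / (2 + d / \<mu>) \<le> s" unfolding s_def using \<mu> d by (intro ln_add_one_lower_bound) simp
    also have "2 * (d / \<mu>) / (2 + d / \<mu>) = 2 * d / (2 * \<mu> + d)" using \<mu> d by (simp add: field_simps)
    finally have "2 * d / (2 * \<mu> + d) * (\<mu> + d) \<le> s * (\<mu> + d)" using \<mu> d by (intro mult_right_mono) auto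
    moreover have "2 * d / (2 * \<mu> + d) * (\<mu> + d) - d = d\<^sup>2 / (2 * \<mu> + d)"
      using \<mu> d by (simp add: field_simps power2_eq_square)
    moreover have "s > 0" unfolding s_def using \<mu> d by (intro ln_gt_zero) simp
    ultimately show ?thesis using e by (intro exI[of _ s]) auto
  qed
  then obtain s where s: "s > 0" "\<mu> * (exp s - 1) - s * (\<mu> + d) \<le> - (d\<^sup>2 / (2 * \<mu> + d))" by blast
  have "{xs. (\<Sum>x\<leftarrow>xs. X x) \<ge> real l * (\<mu> + d)} = {xs. s * (\<Sum>x\<leftarrow>xs. X x) \<ge> s * (real l * (\<mu> + d))}"
    using s by simp
  then have "measure_pmf.prob (replicate_pmf l p) {xs. (\<Sum>x\<leftarrow>xs. X x) \<ge> real l * (\<mu> + d)}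
      \<le> exp (real l * (\<mu> * (exp s - 1)) - s * (real l * (\<mu> + d)))"
    using sum_list_replicate_pmf_tail[OF fin X, where l = l and s = s and c = "s * (real l * (\<mu> + d))"] by (simp only: \<mu>_def)
  also have "\<dots> \<le> exp (- (real l * d\<^sup>2 / (2 * \<mu> + d)))"
    using mult_left_mono[OF s(2), of "real l"] by (simp add: algebra_simps)
  finally show ?thesis .
qed

text \<open>Takes \<open>s = - d\<close> in the general tail bound and uses
  \<open>exp (- d) \<le> 1 - d + d\<^sup>2 / 2\<close>. This choice covers every positive
  \<open>d\<close>, including values of at least 1.\<close>

lemma sum_list_replicate_pmf_lower_tail:
  fixes X :: "'a \<Rightarrow> real"
  assumes fin: "finite (set_pmf p)"
    and X: "\<And>x. x \<in> set_pmf p \<Longrightarrow> 0 \<le> X x \<and> X x \<le> 1"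
    and d: "d > 0"
  defines "\<mu> \<equiv> measure_pmf.expectation p X"
  shows "measure_pmf.prob (replicate_pmf l p) {xs. (\<Sum>x\<leftarrow>xs. X x) \<le> real l * ((1 - d) * \<mu>)}
    \<le> exp (- (real l * \<mu> * d\<^sup>2 / 2))"
proof -
  have \<mu>: "\<mu> \<ge> 0" unfolding \<mu>_def using X by (intro integral_nonneg_AE AE_pmfI) auto
  have "{xs. (\<Sum>x\<leftarrow>xs. X x) \<le> real l * ((1 - d) * \<mu>)}
     = {xs. - d * (\<Sum>x\<leftarrow>xs. X x) \<ge> - d * (real l * ((1 - d) * \<mu>))}"
    using d by simp
  then have "measure_pmf.prob (replicate_pmf l p) {xs. (\<Sum>x\<leftarrow>xs. X x) \<le> real l * ((1 - d) * \<mu>)}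
      \<le> exp (real l * (\<mu> * (exp (- d) - 1)) - (- d * (real l * ((1 - d) * \<mu>))))"
    using sum_list_replicate_pmf_tail[OF fin X, where l = l and s = "- d" and c = "- d * (real l * ((1 - d) * \<mu>))"] by (simp only: \<mu>_def)
  also have "\<dots> \<le> exp (- (real l * \<mu> * d\<^sup>2 / 2))"
  proof -
    let ?f = "\<lambda>x::real. 1 - x + x\<^sup>2 / 2 - exp (- x)"
    have "?f 0 \<le> ?f d"
    proof (rule DERIV_nonneg_imp_nondecreasing[of 0 d])
      fix y :: real
      have "(?f has_real_derivative (- 1 + y + exp (- y))) (at y)"
        by (auto intro!: derivative_eq_intros)
      moreover have "0 \<le> - 1 + y + exp (- y)" using exp_ge_add_one_self[of "- y"] by simp
      ultimately show "\<exists>D. (?f has_real_derivative D) (at y) \<and> 0 \<le> D" by blast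
    qed (use d in auto)
    then have "exp (- d) - 1 \<le> - d + d\<^sup>2 / 2" by simp
    then have "real l * \<mu> * (exp (- d) - 1) \<le> real l * \<mu> * (- d + d\<^sup>2 / 2)"
      using \<mu> by (intro mult_left_mono) auto
    then show ?thesis by (simp add: algebra_simps power2_eq_square)
  qed
  finally show ?thesis .
qed

section \<open>Greedy maximum coverage\<close>

lemma y_cov_mono: "S \<subseteq> T \<Longrightarrow> y_cov P S \<le> y_cov P T"
  by (auto simp: y_cov_def)

text \<open>If \<open>T\<close> meets \<open>P\<close> but \<open>S\<close> does not, a single node
  of \<open>T\<close> already covers \<open>P\<close>. Being linear in the coverage, the inequality
  carries over to \<open>x_cov\<close> and \<open>x_bar\<close>.\<close>

lemma y_cov_le_sum_gains:
  assumes "finite T"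
  shows "y_cov P T - y_cov P S \<le> (\<Sum>v\<in>T. y_cov P (S \<union> {v}) - y_cov P S)"
proof (cases "P \<inter> S = {} \<and> P \<inter> T \<noteq> {}")
  case True
  then obtain v where v: "v \<in> P" "v \<in> T" by blast
  have "y_cov P T - y_cov P S \<le> y_cov P (S \<union> {v}) - y_cov P S"
    using v True by (auto simp: y_cov_def)
  also have "\<dots> \<le> (\<Sum>v\<in>T. y_cov P (S \<union> {v}) - y_cov P S)"
    using v assms by (intro member_le_sum) (auto simp: y_cov_def)
  finally show ?thesis .
next
  case False
  then have "y_cov P T - y_cov P S \<le> 0" by (auto simp: y_cov_def)
  also have "0 \<le> (\<Sum>v\<in>T. y_cov P (S \<union> {v}) - y_cov P S)"
    by (intro sum_nonneg) (auto simp: y_cov_def)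
  finally show ?thesis .
qed

lemma x_cov_mono: "S \<subseteq> T \<Longrightarrow> x_cov \<P> S \<le> x_cov \<P> T"
  unfolding x_cov_def by (intro sum_mset_mono y_cov_mono)

lemma x_cov_le_sum_gains:
  assumes "finite T"
  shows "x_cov \<P> T - x_cov \<P> S \<le> (\<Sum>v\<in>T. x_cov \<P> (S \<union> {v}) - x_cov \<P> S)"
proof (induction \<P>)
  case (add P \<P>)
  then show ?case using y_cov_le_sum_gains[OF assms, of P S]
    by (simp add: x_cov_def sum.distrib sum_subtractf algebra_simps)
qed (simp add: x_cov_def)

lemma x_bar_mono: "S \<subseteq> T \<Longrightarrow> x_bar Rl S \<le> x_bar Rl T"
  unfolding x_bar_def by (intro divide_right_mono sum_list_mono x_cov_mono) auto

lemma x_bar_le_sum_gains: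
  assumes "finite T"
  shows "x_bar Rl T - x_bar Rl S \<le> (\<Sum>v\<in>T. x_bar Rl (S \<union> {v}) - x_bar Rl S)"
proof -
  have "(\<Sum>\<P>\<leftarrow>Rl'. x_cov \<P> T) - (\<Sum>\<P>\<leftarrow>Rl'. x_cov \<P> S)
      \<le> (\<Sum>v\<in>T. (\<Sum>\<P>\<leftarrow>Rl'. x_cov \<P> (S \<union> {v})) - (\<Sum>\<P>\<leftarrow>Rl'. x_cov \<P> S))" for Rl'
  proof (induction Rl')
    case (Cons \<P> Rl')
    then show ?case using x_cov_le_sum_gains[OF assms, of \<P> S]
      by (simp add: sum.distrib sum_subtractf algebra_simps)
  qed simp
  from divide_right_mono[OF this[of Rl], of "real (length Rl)"] show ?thesis
    by (simp add: x_bar_def diff_divide_distrib sum_divide_distrib)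
qed

lemma x_bar_empty [simp]: "x_bar Rl {} = 0"
  by (simp add: x_bar_def x_cov_def y_cov_def)

lemma x_bar_nonneg: "0 \<le> x_bar Rl S"
  using x_bar_mono[of "{}" S Rl] by simp

text \<open>The gap to \<open>T\<close> is at most the sum of the gains of its at most
  \<open>k\<close> nodes, and none of them gains more than the greedy choice; nodes already in
  \<open>S\<close> gain nothing.\<close>

lemma greedy_rule_step:
  assumes rule: "greedy_rule V sel" and V: "finite V" and S: "S \<subset> V" and T: "T \<subseteq> V" "card T \<le> k"
  shows "x_bar Rl T - x_bar Rl S \<le> real k * (x_bar Rl (S \<union> {sel Rl S}) - x_bar Rl S)"
proof -
  have finT: "finite T" using T V finite_subset by auto
  let ?m = "x_bar Rl (S \<union> {sel Rl S}) - x_bar Rl S"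
  have gain: "x_bar Rl (S \<union> {v}) - x_bar Rl S \<le> ?m" if "v \<in> T" for v
  proof (cases "v \<in> S")
    case True
    then show ?thesis using x_bar_mono[of S "S \<union> {sel Rl S}" Rl] by (auto simp: insert_absorb)
  next
    case False
    then have "v \<in> V - S" using that T by auto
    then show ?thesis using rule S unfolding greedy_rule_def is_arg_max_def
      by (meson diff_right_mono linorder_not_less)
  qed
  have "x_bar Rl T - x_bar Rl S \<le> (\<Sum>v\<in>T. x_bar Rl (S \<union> {v}) - x_bar Rl S)"
    by (rule x_bar_le_sum_gains[OF finT])
  also have "\<dots> \<le> real (card T) * ?m" using gain by (intro sum_bounded_above)
  also have "\<dots> \<le> real k * ?m"
    using T x_bar_mono[of S "S \<union> {sel Rl S}" Rl] by (intro mult_right_mono) auto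
  finally show ?thesis .
qed

text \<open>Each round shrinks the gap to \<open>T\<close> by the factor \<open>1 - 1 / k\<close>,
  and \<open>k\<close> rounds leave at most the fraction \<open>1 / e\<close>. As
  \<open>k \<le> card V\<close>, there is always a node left to choose.\<close>

lemma greedy_bound:
  assumes rule: "greedy_rule V sel" and V: "finite V" and k: "0 < k" "k \<le> card V"
    and T: "T \<subseteq> V" "card T \<le> k"
  shows "greedy sel k Rl \<subseteq> V" "card (greedy sel k Rl) = k"
    "x_bar Rl (greedy sel k Rl) \<ge> (1 - 1 / exp 1) * x_bar Rl T"
proof -
  let ?F = "x_bar Rl"
  \<comment> \<open>Every round adds a new node, so \<open>card S\<close> counts the rounds and is
    the exponent in the loop invariant.\<close>
  let ?I = "\<lambda>S. S \<subseteq> V \<and> card S \<le> k \<and> ?F T - ?F S \<le> (1 - 1 / real k) ^ card S * ?F T"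
  have step: "?I (S \<union> {sel Rl S}) \<and> card (S \<union> {sel Rl S}) = Suc (card S)" if S: "?I S" "card S < k" for S
  proof -
    have SV: "S \<subset> V" using S k by auto
    then have sel: "sel Rl S \<in> V - S" using rule unfolding greedy_rule_def is_arg_max_def by blast
    have finS: "finite S" using SV V finite_subset by auto
    have card: "card (S \<union> {sel Rl S}) = Suc (card S)" using sel finS by simp
    have "?F T - ?F S \<le> real k * (?F (S \<union> {sel Rl S}) - ?F S)"
      by (rule greedy_rule_step[OF rule V SV T])
    then have "(?F T - ?F S) / real k \<le> ?F (S \<union> {sel Rl S}) - ?F S"
      using k by (simp add: pos_divide_le_eq mult.commute)
    then have "?F T - ?F (S \<union> {sel Rl S}) \<le> (1 - 1 / real k) * (?F T - ?F S)"
      by (simp add: left_diff_distrib)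
    also have "\<dots> \<le> (1 - 1 / real k) * ((1 - 1 / real k) ^ card S * ?F T)"
      using S k by (intro mult_left_mono) auto
    finally show ?thesis using S SV sel card by auto
  qed
  have "?I (greedy sel k Rl) \<and> \<not> card (greedy sel k Rl) < k"
    unfolding greedy_def
  proof (rule while_rule[where P = ?I and r = "Wellfounded.measure (\<lambda>S. k - card S)"])
    show "?I {}" using k by simp
    show "?I (S \<union> {sel Rl S})" if "?I S" "card S < k" for S using step[OF that] by blast
    show "(S \<union> {sel Rl S}, S) \<in> Wellfounded.measure (\<lambda>S. k - card S)" if "?I S" "card S < k" for S
      using step[OF that] that by auto
  qed auto
  then have I: "?I (greedy sel k Rl)" and card: "card (greedy sel k Rl) = k" by auto
  show "greedy sel k Rl \<subseteq> V" using I by blast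
  show "card (greedy sel k Rl) = k" by (fact card)
  have "(1 - 1 / real k) ^ k \<le> exp (- 1 / real k) ^ k"
    using k exp_ge_add_one_self[of "- 1 / real k"] by (intro power_mono) auto
  also have "\<dots> = exp (real k * (- 1 / real k))" by (rule exp_of_nat_mult[symmetric])
  also have "real k * (- 1 / real k) = - 1" using k by simp
  also have "exp (- 1 :: real) = 1 / exp 1" by (simp add: exp_minus inverse_eq_divide)
  finally have "(1 - 1 / real k) ^ k * ?F T \<le> 1 / exp 1 * ?F T"
    by (intro mult_right_mono x_bar_nonneg)
  then show "x_bar Rl (greedy sel k Rl) \<ge> (1 - 1 / exp 1) * x_bar Rl T"
    using I unfolding card left_diff_distrib by linarith
qed

section \<open>Success probability\<close>

lemma finite_set_realization: "finite (parcs G) \<Longrightarrow> finite (set_pmf (realization G pr))"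
  unfolding realization_def
  by (rule finite_subset[OF set_Pi_pmf_subset' finite_PiE_dflt]) auto

lemma x_cov_full_sample:
  assumes "distinct (ord ((live E g)\<^sup>* `` Sr))" "set (ord ((live E g)\<^sup>* `` Sr)) = (live E g)\<^sup>* `` Sr"
  shows "x_cov (full_sample E Sr ord g) S = (\<Sum>v\<in>(live E g)\<^sup>* `` Sr. y_cov (closer (live E g) Sr v) S)"
proof -
  have "x_cov (full_sample E Sr ord g) S
      = sum_list (map (\<lambda>v. y_cov (closer (live E g) Sr v) S) (ord ((live E g)\<^sup>* `` Sr)))"
    by (simp add: x_cov_def full_sample_def sum_mset_sum_list o_def flip: mset_map)
  then show ?thesis using assms by (simp add: sum_list_distinct_conv_sum_set)
qed

text \<open>The identity holds realization by realization, by
  \<open>card_never_misinformed_diff\<close>, and is then averaged.\<close>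

lemma expectation_x_cov_full_sample:
  fixes G :: "'v pair_pre_digraph"
  assumes V: "finite (pverts G)" and E: "finite (parcs G)" "parcs G \<subseteq> pverts G \<times> pverts G"
    and Sr: "Sr \<subseteq> pverts G"
    and ord: "\<And>A. A \<subseteq> pverts G \<Longrightarrow> distinct (ord A) \<and> set (ord A) = A"
  shows "measure_pmf.expectation (map_pmf (full_sample (parcs G) Sr ord) (realization G pr)) (\<lambda>P. x_cov P S)
    = f_star G pr Sr S"
proof -
  have "x_cov (full_sample (parcs G) Sr ord g) S
      = real (card (never_misinformed G g Sr S)) - real (card (never_misinformed G g Sr {}))" for g
  proof -
    have "(live (parcs G) g)\<^sup>* `` Sr \<subseteq> pverts G"
      using E Sr by (intro rtrancl_Image_subset) (auto simp: live_def)
    then show ?thesis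
      using ord by (subst x_cov_full_sample) (auto simp: card_never_misinformed_diff[OF V E(2) Sr])
  qed
  then show ?thesis
    using finite_set_realization[OF E(1), of pr]
    by (simp add: f_star_def f_obj_def integrable_measure_pmf_finite)
qed

lemma x_cov_bounds: "0 \<le> x_cov P S" "x_cov P S \<le> real (size P)"
  by (induction P) (auto simp: x_cov_def y_cov_def)

text \<open>Each reached node contributes one set. Dividing \<open>x_cov\<close> by the number of
  nodes therefore gives a variable in [0, 1], as the Chernoff bounds require.\<close>

lemma size_full_sample:
  fixes G :: "'v pair_pre_digraph"
  assumes V: "finite (pverts G)" and E: "parcs G \<subseteq> pverts G \<times> pverts G"
    and Sr: "Sr \<subseteq> pverts G"
    and ord: "\<And>A. A \<subseteq> pverts G \<Longrightarrow> distinct (ord A) \<and> set (ord A) = A"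
  shows "size (full_sample (parcs G) Sr ord g) \<le> card (pverts G)"
proof -
  have sub: "(live (parcs G) g)\<^sup>* `` Sr \<subseteq> pverts G"
    using E Sr by (intro rtrancl_Image_subset) (auto simp: live_def)
  then have "length (ord ((live (parcs G) g)\<^sup>* `` Sr)) = card ((live (parcs G) g)\<^sup>* `` Sr)"
    using ord distinct_card by metis
  then show ?thesis using card_mono[OF V sub] by (simp add: full_sample_def)
qed

lemma x_bar_tails:
  fixes p :: "'v set multiset pmf" and S :: "'v set"
  assumes fin: "finite (set_pmf p)" and n: "n > 0" and size: "\<And>P. P \<in> set_pmf p \<Longrightarrow> size P \<le> n"
    and l: "l > 0" and d: "d > 0"
  defines "\<mu> \<equiv> measure_pmf.expectation p (\<lambda>P. x_cov P S)"
  shows "measure_pmf.prob (replicate_pmf l p) {Rl. x_bar Rl S \<ge> \<mu> + d}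
      \<le> exp (- (real l * d\<^sup>2 / (real n * (2 * \<mu> + d))))"
    and "measure_pmf.prob (replicate_pmf l p) {Rl. x_bar Rl S \<le> (1 - d) * \<mu>}
      \<le> exp (- (real l * \<mu> * d\<^sup>2 / (2 * real n)))"
proof -
  let ?X = "\<lambda>P. x_cov P S / real n"
  have X: "0 \<le> ?X P \<and> ?X P \<le> 1" if "P \<in> set_pmf p" for P
    using x_cov_bounds[of P S] size[OF that] n by (simp add: divide_le_eq)
  have mean: "measure_pmf.expectation p ?X = \<mu> / real n"
    unfolding \<mu>_def by simp
  have sum: "(\<Sum>P\<leftarrow>Rl. ?X P) = real l * x_bar Rl S / real n" if "Rl \<in> set_pmf (replicate_pmf l p)" for Rl
    using that l by (simp add: x_bar_def set_replicate_pmf divide_inverse sum_list_mult_const)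
  have "measure_pmf.prob (replicate_pmf l p) {Rl. x_bar Rl S \<ge> \<mu> + d}
      \<le> measure_pmf.prob (replicate_pmf l p) {Rl. (\<Sum>P\<leftarrow>Rl. ?X P) \<ge> real l * (\<mu> / real n + d / real n)}"
    using n by (intro measure_pmf.finite_measure_mono_AE AE_pmfI)
      (auto simp: sum divide_right_mono mult_left_mono simp flip: add_divide_distrib)
  also have "\<dots> \<le> exp (- (real l * (d / real n)\<^sup>2 / (2 * (\<mu> / real n) + d / real n)))"
    using sum_list_replicate_pmf_upper_tail[where X = ?X and d = "d / real n" and l = l, OF fin X] d n unfolding mean by simp
  also have "real l * (d / real n)\<^sup>2 / (2 * (\<mu> / real n) + d / real n) = real l * d\<^sup>2 / (real n * (2 * \<mu> + d))"
    using n by (simp add: power2_eq_square flip: add_divide_distrib)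
  finally show "measure_pmf.prob (replicate_pmf l p) {Rl. x_bar Rl S \<ge> \<mu> + d}
      \<le> exp (- (real l * d\<^sup>2 / (real n * (2 * \<mu> + d))))" .
  have "measure_pmf.prob (replicate_pmf l p) {Rl. x_bar Rl S \<le> (1 - d) * \<mu>}
      \<le> measure_pmf.prob (replicate_pmf l p) {Rl. (\<Sum>P\<leftarrow>Rl. ?X P) \<le> real l * ((1 - d) * (\<mu> / real n))}"
    using n by (intro measure_pmf.finite_measure_mono_AE AE_pmfI)
      (auto simp: sum divide_right_mono mult_left_mono)
  also have "\<dots> \<le> exp (- (real l * (\<mu> / real n) * d\<^sup>2 / 2))"
    using sum_list_replicate_pmf_lower_tail[where X = ?X and d = d and l = l, OF fin X] d unfolding mean by simp
  also have "real l * (\<mu> / real n) * d\<^sup>2 / 2 = real l * \<mu> * d\<^sup>2 / (2 * real n)"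
    by simp
  finally show "measure_pmf.prob (replicate_pmf l p) {Rl. x_bar Rl S \<le> (1 - d) * \<mu>}
      \<le> exp (- (real l * \<mu> * d\<^sup>2 / (2 * real n)))" .
qed

text \<open>The factor \<open>(1 + \<epsilon>)\<^sup>2\<close> in the sample size allows for an
  estimate that exceeds the optimum by that factor. Outside the bad events the optimum is not
  underestimated much and the output is not overestimated much.\<close>

lemma greedy_sampling_success:
  fixes p :: "'v set multiset pmf" and V :: "'v set" and f :: "'v set \<Rightarrow> real"
  assumes fin: "finite (set_pmf p)" and size: "\<And>P. P \<in> set_pmf p \<Longrightarrow> size P \<le> card V"
    and f: "\<And>S. f S = measure_pmf.expectation p (\<lambda>P. x_cov P S)"
    and V: "finite V" and k: "0 < k" "k \<le> card V"
    and rule: "greedy_rule V sel"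
    and T: "T \<subseteq> V" "card T \<le> k" and opt: "\<And>S. S \<subseteq> V \<Longrightarrow> card S \<le> k \<Longrightarrow> f S \<le> f T"
    and pos: "f T > 0" and eps: "\<epsilon> > 0" and N: "N > 1"
    and feasible: "feasible_eps \<epsilon> (\<epsilon>11, \<epsilon>12)"
    and l: "real l \<ge> max (l1 (card V) k N \<epsilon> \<epsilon>11) (l2 (card V) N \<epsilon>12) / ((1 + \<epsilon>)\<^sup>2 * f T)"
  shows "measure_pmf.prob (replicate_pmf l p)
    {Rl. f (greedy sel k Rl) \<ge> (1 - 1 / exp 1 - \<epsilon>) * f T} \<ge> 1 - 2 / N"
proof -
  let ?n = "real (card V)" and ?O = "f T" and ?q = "replicate_pmf l p"
  let ?m = "real (card V choose k)"
  have e: "0 < \<epsilon>11" "0 < \<epsilon>12" and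
    feas: "(1 - \<epsilon>12 * (1 + \<epsilon>)) * (1 - 1 / exp 1) - \<epsilon>11 * (1 + \<epsilon>) = 1 - 1 / exp 1 - \<epsilon>"
    using feasible by (auto simp: feasible_eps_def)
  have n: "card V > 0" "?n > 0" using k by auto
  have m: "?m \<ge> 1" using k by (simp add: Suc_leI)
  have lnN: "ln N > 0" using N by simp
  \<comment> \<open>Both deviations carry a factor \<open>1 + \<epsilon>\<close>, whose square in
    the exponents cancels the possible shortage of samples.\<close>
  define d1 where "d1 = \<epsilon>11 * (1 + \<epsilon>) * ?O"
  define d2 where "d2 = \<epsilon>12 * (1 + \<epsilon>)"
  have d: "d1 > 0" "d2 > 0" using e eps pos by (auto simp: d1_def d2_def)
  have l1: "real l * ((1 + \<epsilon>)\<^sup>2 * ?O) \<ge> l1 (card V) k N \<epsilon> \<epsilon>11"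
    and l2: "real l * ((1 + \<epsilon>)\<^sup>2 * ?O) \<ge> l2 (card V) N \<epsilon>12"
    using l eps pos by (auto simp: pos_divide_le_eq)
  have l2_pos: "l2 (card V) N \<epsilon>12 > 0" using n lnN e by (simp add: l2_def)
  have l_pos: "l > 0"
  proof (rule ccontr)
    assume "\<not> l > 0" then show False using l2 l2_pos by simp
  qed
  define B1 where "B1 = {Rl. x_bar Rl T \<le> (1 - d2) * ?O}"
  define B2 where "B2 = (\<lambda>S. {Rl. x_bar Rl S \<ge> f S + d1})"
  \<comment> \<open>Greedy returns exactly \<open>k\<close> nodes, so the union bound ranges over
    the sets of that size only.\<close>
  define \<S> where "\<S> = {S. S \<subseteq> V \<and> card S = k}"
  have \<S>: "finite \<S>" "card \<S> = card V choose k"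
    unfolding \<S>_def using V by (auto simp: n_subsets)
  have "measure_pmf.prob ?q B1 \<le> exp (- (real l * ?O * d2\<^sup>2 / (2 * ?n)))"
    unfolding B1_def f using fin n(1) size l_pos d(2) by (intro x_bar_tails(2))
  also have "\<dots> \<le> exp (- ln N)"
  proof -
    have "2 * ?n * ln N \<le> real l * ((1 + \<epsilon>)\<^sup>2 * ?O) * \<epsilon>12\<^sup>2"
      using l2 e by (simp add: l2_def pos_divide_le_eq)
    also have "\<dots> = real l * ?O * d2\<^sup>2" by (simp add: d2_def power_mult_distrib)
    finally have "ln N \<le> real l * ?O * d2\<^sup>2 / (2 * ?n)" using n by (simp add: pos_le_divide_eq mult_ac)
    then show ?thesis by simp
  qed
  finally have B1: "measure_pmf.prob ?q B1 \<le> 1 / N" using N by (simp add: exp_minus inverse_eq_divide)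
  have B2: "measure_pmf.prob ?q (B2 S) \<le> 1 / (?m * N)" if S: "S \<in> \<S>" for S
  proof -
    have fS: "f S \<le> ?O" using S opt by (auto simp: \<S>_def)
    have fS0: "f S \<ge> 0" unfolding f by (intro integral_nonneg_AE AE_pmfI x_cov_bounds(1))
    have "measure_pmf.prob ?q (B2 S) \<le> exp (- (real l * d1\<^sup>2 / (?n * (2 * f S + d1))))"
      unfolding B2_def f using fin n(1) size l_pos d(1) by (intro x_bar_tails(1))
    also have "\<dots> \<le> exp (- (ln ?m + ln N))"
    proof -
      have "(ln ?m + ln N) * (?n * (2 * ?O + d1)) = ?n * (ln ?m + ln N) * (2 + \<epsilon>11 * (1 + \<epsilon>)) * ?O"
        by (simp add: d1_def algebra_simps)
      also have "\<dots> \<le> (real l * ((1 + \<epsilon>)\<^sup>2 * ?O) * \<epsilon>11\<^sup>2) * ?O"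
        using l1 e pos by (intro mult_right_mono) (simp_all add: l1_def pos_divide_le_eq)
      also have "\<dots> = real l * d1\<^sup>2" by (simp add: d1_def power2_eq_square)
      finally have "ln ?m + ln N \<le> real l * d1\<^sup>2 / (?n * (2 * ?O + d1))"
        using n pos d by (subst pos_le_divide_eq) auto
      \<comment> \<open>A smaller mean only improves the exponent, so the bound at the optimal value
        holds for every candidate.\<close>
      also have "\<dots> \<le> real l * d1\<^sup>2 / (?n * (2 * f S + d1))"
        using n pos d fS fS0 by (intro divide_left_mono mult_left_mono mult_pos_pos) auto
      finally show ?thesis by simp
    qed
    also have "\<dots> = 1 / (?m * N)"
    proof -
      have "exp (ln ?m + ln N) = ?m * N" using N m by (subst exp_add) (simp add: k)
      then show ?thesis by (simp only: exp_minus inverse_eq_divide)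
    qed
    finally show ?thesis .
  qed
  have "measure_pmf.prob ?q (B1 \<union> (\<Union>S\<in>\<S>. B2 S)) \<le> measure_pmf.prob ?q B1 + measure_pmf.prob ?q (\<Union>S\<in>\<S>. B2 S)"
    by (rule measure_Un_le) auto
  also have "measure_pmf.prob ?q (\<Union>S\<in>\<S>. B2 S) \<le> (\<Sum>S\<in>\<S>. measure_pmf.prob ?q (B2 S))"
    using \<S> by (intro measure_UNION_le) auto
  also have "\<dots> \<le> (\<Sum>S\<in>\<S>. 1 / (?m * N))" by (intro sum_mono B2)
  also have "\<dots> = 1 / N" using \<S> k by simp
  finally have bad: "measure_pmf.prob ?q (B1 \<union> (\<Union>S\<in>\<S>. B2 S)) \<le> 2 / N" using B1 by simp
  have "f (greedy sel k Rl) \<ge> (1 - 1 / exp 1 - \<epsilon>) * ?O" if Rl: "Rl \<notin> B1 \<union> (\<Union>S\<in>\<S>. B2 S)" for Rl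
  proof -
    note g = greedy_bound[OF rule V k T, of Rl]
    have "greedy sel k Rl \<in> \<S>" using g by (simp add: \<S>_def)
    then have "f (greedy sel k Rl) + d1 > x_bar Rl (greedy sel k Rl)" using Rl by (auto simp: B2_def)
    moreover have "(1 - 1 / exp 1) * ((1 - d2) * ?O) \<le> (1 - 1 / exp 1) * x_bar Rl T"
      using Rl by (intro mult_left_mono) (auto simp: B1_def)
    \<comment> \<open>The constraint on \<open>\<epsilon>11\<close> and \<open>\<epsilon>12\<close>
      makes the greedy loss and the two deviations add up to exactly the target.\<close>
    moreover have "(1 - 1 / exp 1 - \<epsilon>) * ?O = (1 - 1 / exp 1) * ((1 - d2) * ?O) - d1"
      unfolding feas[symmetric] d1_def d2_def by (simp add: algebra_simps)
    ultimately show ?thesis using g(3) by linarith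
  qed
  then have "- (B1 \<union> (\<Union>S\<in>\<S>. B2 S)) \<subseteq> {Rl. f (greedy sel k Rl) \<ge> (1 - 1 / exp 1 - \<epsilon>) * ?O}"
    by blast
  then have "measure_pmf.prob ?q (- (B1 \<union> (\<Union>S\<in>\<S>. B2 S)))
    \<le> measure_pmf.prob ?q {Rl. f (greedy sel k Rl) \<ge> (1 - 1 / exp 1 - \<epsilon>) * ?O}"
    by (intro measure_pmf.finite_measure_mono) auto
  moreover have "measure_pmf.prob ?q (- (B1 \<union> (\<Union>S\<in>\<S>. B2 S))) = 1 - measure_pmf.prob ?q (B1 \<union> (\<Union>S\<in>\<S>. B2 S))"
    using measure_pmf.prob_compl[of "B1 \<union> (\<Union>S\<in>\<S>. B2 S)" ?q] by (simp add: Compl_eq_Diff_UNIV)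
  ultimately show ?thesis using bad by linarith
qed

text \<open>Averages the conditional bounds and discards the draws outside \<open>A\<close>; it
  joins the estimation step to the sampling step.\<close>

lemma measure_bind_pmf_ge:
  assumes "\<And>x. x \<in> A \<Longrightarrow> measure_pmf.prob (K x) B \<ge> c" "c \<ge> 0"
  shows "measure_pmf.prob (bind_pmf p K) B \<ge> c * measure_pmf.prob p A"
proof -
  have "ennreal (c * measure_pmf.prob p A) = (\<integral>\<^sup>+x. ennreal c * indicator A x \<partial>measure_pmf p)"
    using assms(2) by (simp add: nn_integral_cmult measure_pmf.emeasure_eq_measure ennreal_mult)
  also have "\<dots> \<le> (\<integral>\<^sup>+x. emeasure (measure_pmf (K x)) B \<partial>measure_pmf p)"
    using assms by (intro nn_integral_mono)
      (auto simp: measure_pmf.emeasure_eq_measure ennreal_leI split: split_indicator)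
  also have "\<dots> = emeasure (measure_pmf (bind_pmf p K)) B"
    by (rule emeasure_bind_pmf[symmetric])
  also have "\<dots> = ennreal (measure_pmf.prob (bind_pmf p K) B)"
    by (rule measure_pmf.emeasure_eq_measure)
  finally show ?thesis by simp
qed

text \<open>Tie-breaking, processing order and the minimising pair are arbitrary, and mass lost by
  \<open>hmp\<close> counts as failure. Positivity of the estimate is part of the assumed guarantee,
  because the sample size divides by it.\<close>

theorem theorem1:
  fixes G :: "'v pair_pre_digraph"
    and pr :: "'v \<times> 'v \<Rightarrow> real"
    and Sr S\<^sub>L S\<^sub>o\<^sub>p\<^sub>t :: "'v set"
    and k :: nat
    and \<epsilon> N \<epsilon>\<^sub>0 :: real
    and \<epsilon>11 \<epsilon>12 :: real
    and est :: "real pmf"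
    and ord :: "'v set \<Rightarrow> 'v list"
    and sel :: "'v set multiset list \<Rightarrow> 'v set \<Rightarrow> 'v"
  assumes graph: "pair_fin_digraph G"
    and prob: "\<And>e. e \<in> parcs G \<Longrightarrow> 0 < pr e \<and> pr e \<le> 1"
    and seeds: "Sr \<subseteq> pverts G"
    and params: "k > 0" "0 < \<epsilon>" "\<epsilon> < 1" "N > 1"
    and opt: "is_arg_max (f_star G pr Sr) (\<lambda>S. S \<subseteq> pverts G \<and> card S \<le> k) S\<^sub>o\<^sub>p\<^sub>t"
    and S_L: "S\<^sub>L \<subseteq> pverts G" "card S\<^sub>L = k"
    and eps0: "\<epsilon>\<^sub>0 = \<epsilon>\<^sup>2 + 2 * \<epsilon>"
    and estimate: "measure_pmf.prob est
        {x. 0 < x \<and> (1 - \<epsilon>\<^sub>0) * f_star G pr Sr S\<^sub>L \<le> x \<and> x \<le> (1 + \<epsilon>\<^sub>0) * f_star G pr Sr S\<^sub>L}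
      \<ge> 1 - 1 / N"
    and eps: "optimal_eps (card (pverts G)) k N \<epsilon> (\<epsilon>11, \<epsilon>12)"
    and order: "\<And>A. A \<subseteq> pverts G \<Longrightarrow> distinct (ord A) \<and> set (ord A) = A"
    and greedy_choice: "greedy_rule (pverts G) sel"
  shows "measure (measure_spmf (hmp G pr Sr k \<epsilon> N est (\<epsilon>11, \<epsilon>12) ord sel))
      {S. f_star G pr Sr S \<ge> (1 - 1 / exp 1 - \<epsilon>) * f_star G pr Sr S\<^sub>o\<^sub>p\<^sub>t}
    \<ge> 1 - 3 / N"
proof -
  interpret pair_fin_digraph G by (fact graph)
  let ?V = "pverts G" and ?f = "f_star G pr Sr"
  have V: "finite ?V" and E: "finite (parcs G)" "parcs G \<subseteq> ?V \<times> ?V"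
    using pair_finite_verts pair_finite_arcs in_arcsD1 in_arcsD2 by auto
  define p where "p = map_pmf (full_sample (parcs G) Sr ord) (realization G pr)"
  have fin: "finite (set_pmf p)" using finite_set_realization[OF E(1), of pr] by (simp add: p_def)
  have size: "size P \<le> card ?V" if "P \<in> set_pmf p" for P
    using that size_full_sample[OF V E(2) seeds order] by (auto simp: p_def)
  have f: "?f S = measure_pmf.expectation p (\<lambda>P. x_cov P S)" for S
    unfolding p_def by (rule expectation_x_cov_full_sample[OF V E seeds order, symmetric])
  have r_sample: "r_sample G pr Sr ord = spmf_of_pmf p"
    unfolding p_def using order by (intro r_sample_eq V E seeds) auto
  have k: "k \<le> card ?V" using S_L card_mono[OF V] by blast
  have T: "S\<^sub>o\<^sub>p\<^sub>t \<subseteq> ?V" "card S\<^sub>o\<^sub>p\<^sub>t \<le> k"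
    and T_max: "\<And>S. S \<subseteq> ?V \<Longrightarrow> card S \<le> k \<Longrightarrow> ?f S \<le> ?f S\<^sub>o\<^sub>p\<^sub>t"
    using opt by (auto simp: is_arg_max_def not_less)
  have feasible: "feasible_eps \<epsilon> (\<epsilon>11, \<epsilon>12)"
    using eps by (simp add: optimal_eps_def is_arg_min_def)
  define X where "X = {x. 0 < x \<and> (1 - \<epsilon>\<^sub>0) * ?f S\<^sub>L \<le> x \<and> x \<le> (1 + \<epsilon>\<^sub>0) * ?f S\<^sub>L}"
  define Good where "Good = {S. ?f S \<ge> (1 - 1 / exp 1 - \<epsilon>) * ?f S\<^sub>o\<^sub>p\<^sub>t}"
  define M where "M = max (l1 (card ?V) k N \<epsilon> \<epsilon>11) (l2 (card ?V) N \<epsilon>12)"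
  define K where "K = (\<lambda>x. if x > 0 then map_spmf (greedy sel k)
      (replicate_spmf (nat \<lceil>M / x\<rceil>) (r_sample G pr Sr ord)) else return_pmf None)"
  have hmp: "hmp G pr Sr k \<epsilon> N est (\<epsilon>11, \<epsilon>12) ord sel = bind_pmf est K"
    by (simp only: hmp_def K_def M_def Let_def prod.case)
  have M: "M \<ge> 0"
  proof -
    have "0 \<le> l2 (card ?V) N \<epsilon>12" using params by (simp add: l2_def)
    then show ?thesis by (simp add: M_def)
  qed
  \<comment> \<open>The maximum with 0 supplies the nonnegative bound that
    \<open>measure_bind_pmf_ge\<close> asks for when \<open>N < 2\<close>.\<close>
  have step: "measure_pmf.prob (K x) (Some ` Good) \<ge> max 0 (1 - 2 / N)" if x: "x \<in> X" for x
  proof -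
    \<comment> \<open>Here \<open>1 + \<epsilon>\<^sub>0 = (1 + \<epsilon>)\<^sup>2\<close>, which
      is the factor in \<open>greedy_sampling_success\<close>.\<close>
    have x0: "x > 0" and "x \<le> (1 + \<epsilon>)\<^sup>2 * ?f S\<^sub>L"
      using x by (auto simp: X_def eps0 power2_eq_square algebra_simps)
    note this(2)
    also have "(1 + \<epsilon>)\<^sup>2 * ?f S\<^sub>L \<le> (1 + \<epsilon>)\<^sup>2 * ?f S\<^sub>o\<^sub>p\<^sub>t" using T_max[of S\<^sub>L] S_L by (intro mult_left_mono) auto
    finally have xT: "x \<le> (1 + \<epsilon>)\<^sup>2 * ?f S\<^sub>o\<^sub>p\<^sub>t" .
    then have pos: "?f S\<^sub>o\<^sub>p\<^sub>t > 0" using x0 params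
      by (smt (verit) mult_nonneg_nonpos zero_le_power2)
    have "M / ((1 + \<epsilon>)\<^sup>2 * ?f S\<^sub>o\<^sub>p\<^sub>t) \<le> M / x"
      using xT x0 M pos params by (intro divide_left_mono mult_pos_pos) auto
    also have "\<dots> \<le> real (nat \<lceil>M / x\<rceil>)" by (rule real_nat_ceiling_ge)
    finally have "1 - 2 / N \<le> measure_pmf.prob (replicate_pmf (nat \<lceil>M / x\<rceil>) p) {Rl. greedy sel k Rl \<in> Good}"
      unfolding Good_def mem_Collect_eq M_def
      by (intro greedy_sampling_success[OF fin size f V params(1) k greedy_choice T T_max pos params(2,4) feasible])
    also have "{Rl. greedy sel k Rl \<in> Good} = (\<lambda>Rl. Some (greedy sel k Rl)) -` Some ` Good" by auto
    finally have "1 - 2 / N \<le> measure_pmf.prob (map_pmf (\<lambda>Rl. Some (greedy sel k Rl)) (replicate_pmf (nat \<lceil>M / x\<rceil>) p))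
      (Some ` Good)" unfolding measure_map_pmf .
    moreover have "K x = map_pmf (\<lambda>Rl. Some (greedy sel k Rl)) (replicate_pmf (nat \<lceil>M / x\<rceil>) p)"
      unfolding K_def r_sample replicate_spmf_of_pmf
      using x0 by (simp add: spmf_of_pmf_def pmf.map_comp o_def)
    ultimately show ?thesis by simp
  qed
  \<comment> \<open>The estimate fails with probability at most \<open>1 / N\<close> and the
    sampling with at most \<open>2 / N\<close>; for \<open>N < 2\<close> the left side is
    negative.\<close>
  have "1 - 3 / N \<le> max 0 (1 - 2 / N) * (1 - 1 / N)"
  proof (cases "N \<ge> 2")
    case True
    have "1 - 3 / N \<le> (1 - 2 / N) * (1 - 1 / N)" using params by (simp add: field_simps power2_eq_square)
    also have "\<dots> \<le> max 0 (1 - 2 / N) * (1 - 1 / N)" using params by (intro mult_right_mono) auto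
    finally show ?thesis .
  next
    case False
    then have "1 - 3 / N \<le> 0" using params by (simp add: field_simps)
    also have "0 \<le> max 0 (1 - 2 / N) * (1 - 1 / N)" using params by (intro mult_nonneg_nonneg) auto
    finally show ?thesis .
  qed
  also have "\<dots> \<le> max 0 (1 - 2 / N) * measure_pmf.prob est X"
    using estimate unfolding X_def by (intro mult_left_mono) auto
  also have "\<dots> \<le> measure_pmf.prob (bind_pmf est K) (Some ` Good)"
    using step by (intro measure_bind_pmf_ge) auto
  also have "\<dots> = measure (measure_spmf (hmp G pr Sr k \<epsilon> N est (\<epsilon>11, \<epsilon>12) ord sel)) Good"
    unfolding hmp measure_measure_spmf_conv_measure_pmf ..
  finally show ?thesis unfolding Good_def .
qed

end
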